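(* Every non-separating planar graph is (1) an outerplanar graph, or (2) a subgraph of a wheel, or (3) a subgraph of an elongated triangular prism.
   Context: A planar drawing of a graph is a drawing in the plane in which no two edges cross. A cycle $C$ in a planar drawing is separating if at least one vertex lies in the interior of $C$ and at least one vertex lies in its exterior; a graph is a non-separating planar graph if it has a planar drawing with no separating cycle. A graph is outerplanar if it can be drawn without crossings in a closed disk with all vertices on the boundary of the disk. A wheel consists of a cycle $C_n$ ($n\ge 3$) together with an extra vertex (the hub) adjacent to every vertex of the cycle. The triangular prism is the graph consisting of two vertex-disjoint triangles $a_1a_2a_3$ and $b_1b_2b_3$ together with the three edges $a_ib_i$ ($i=1,2,3$) (the side-edges). An elongated triangular prism is a graph obtained from the triangular prism by subdividing each of the side-edges $a_ib_i$ any number (possibly zero) of times, i.e. replacing each $a_ib_i$ by an $a_ib_i$-path of length at least $1$, internally disjoint from everything else. *)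

theory Defs
  imports "HOL-Analysis.Analysis"
begin

datatype 'v graph = Graph (verts: "'v set") (edges: "'v set set")

definition finite_simple_graph :: "'v graph \<Rightarrow> bool" where
  "finite_simple_graph G \<longleftrightarrow>
     finite (verts G) \<and> (\<forall>e\<in>edges G. e \<subseteq> verts G \<and> card e = 2)"

text \<open>\<open>G\<close> is a subgraph of \<open>H\<close> up to renaming of vertices; the vertex types may differ.\<close>

definition isomorphic_to_subgraph :: "'v graph \<Rightarrow> 'w graph \<Rightarrow> bool" where
  "isomorphic_to_subgraph G H \<longleftrightarrow>
     (\<exists>f. inj_on f (verts G) \<and> f ` verts G \<subseteq> verts H \<and> (\<lambda>e. f ` e) ` edges G \<subseteq> edges H)"

definition cycle_edges :: "'v list \<Rightarrow> 'v set set" where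
  "cycle_edges vs = {{vs ! i, vs ! (Suc i mod length vs)} | i. i < length vs}"

definition cycle_in :: "'v graph \<Rightarrow> 'v list \<Rightarrow> bool" where
  "cycle_in G vs \<longleftrightarrow>
     length vs \<ge> 3 \<and> distinct vs \<and> set vs \<subseteq> verts G \<and> cycle_edges vs \<subseteq> edges G"

text \<open>
  A vertex \<open>v\<close> is drawn as the point \<open>p v\<close> and an edge \<open>e\<close> as the arc \<open>\<gamma> e\<close>, traversed in
  either direction. Edges are arbitrary continuous arcs, an edge meets no vertex
  other than its ends, and two edges meet only in a common end.
\<close>

definition planar_drawing ::
    "'v graph \<Rightarrow> ('v \<Rightarrow> complex) \<Rightarrow> ('v set \<Rightarrow> real \<Rightarrow> complex) \<Rightarrow> bool" where
  "planar_drawing G p \<gamma> \<longleftrightarrow>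
     inj_on p (verts G) \<and>
     (\<forall>e\<in>edges G. arc (\<gamma> e) \<and> {pathstart (\<gamma> e), pathfinish (\<gamma> e)} = p ` e \<and>
        path_image (\<gamma> e) \<inter> p ` verts G = p ` e) \<and>
     (\<forall>e\<in>edges G. \<forall>e'\<in>edges G. e \<noteq> e' \<longrightarrow>
        path_image (\<gamma> e) \<inter> path_image (\<gamma> e') \<subseteq> p ` (e \<inter> e'))"

definition cycle_curve :: "('v set \<Rightarrow> real \<Rightarrow> complex) \<Rightarrow> 'v list \<Rightarrow> complex set" where
  "cycle_curve \<gamma> vs = (\<Union>e\<in>cycle_edges vs. path_image (\<gamma> e))"

definition separating_cycle ::
    "'v graph \<Rightarrow> ('v \<Rightarrow> complex) \<Rightarrow> ('v set \<Rightarrow> real \<Rightarrow> complex) \<Rightarrow> 'v list \<Rightarrow> bool" where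
  "separating_cycle G p \<gamma> vs \<longleftrightarrow>
     cycle_in G vs \<and>
     (\<exists>u\<in>verts G. p u \<in> inside (cycle_curve \<gamma> vs)) \<and>
     (\<exists>w\<in>verts G. p w \<in> outside (cycle_curve \<gamma> vs))"

definition nonseparating_planar :: "'v graph \<Rightarrow> bool" where
  "nonseparating_planar G \<longleftrightarrow>
     (\<exists>p \<gamma>. planar_drawing G p \<gamma> \<and> \<not> (\<exists>vs. separating_cycle G p \<gamma> vs))"

definition outerplanar :: "'v graph \<Rightarrow> bool" where
  "outerplanar G \<longleftrightarrow>
     (\<exists>p \<gamma> c r. 0 < r \<and> planar_drawing G p \<gamma> \<and>
        p ` verts G \<subseteq> sphere c r \<and> (\<forall>e\<in>edges G. path_image (\<gamma> e) \<subseteq> cball c r))"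

text \<open>The rim vertices are \<open>0, \<dots>, n - 1\<close>; the hub is \<open>n\<close>.\<close>

definition wheel :: "nat \<Rightarrow> nat graph" where
  "wheel n = Graph {..n}
     ({{i, Suc i mod n} | i. i < n} \<union> {{i, n} | i. i < n})"

text \<open>
  The side-edge from \<open>a\<^sub>i\<close> to \<open>b\<^sub>i\<close> (\<open>i < 3\<close>) is replaced by the path
  \<open>(i, 0), (i, 1), \<dots>, (i, l i)\<close> of length \<open>l i\<close>, where \<open>a\<^sub>i = (i, 0)\<close> and \<open>b\<^sub>i = (i, l i)\<close>.
  Only meaningful when every \<open>l i\<close> with \<open>i < 3\<close> is positive.
\<close>

definition elongated_prism :: "(nat \<Rightarrow> nat) \<Rightarrow> (nat \<times> nat) graph" where
  "elongated_prism l = Graph {(i, j) | i j. i < 3 \<and> j \<le> l i}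
     ({{(i, 0), (k, 0)} | i k. i < 3 \<and> k < 3 \<and> i \<noteq> k} \<union>
      {{(i, l i), (k, l k)} | i k. i < 3 \<and> k < 3 \<and> i \<noteq> k} \<union>
      {{(i, j), (i, Suc j)} | i j. i < 3 \<and> j < l i})"

end

theory Submission
  imports Defs
begin

text \<open>A theta consists of three internally disjoint \<open>x\<close>-\<open>y\<close> paths. By the Jordan curve theorem and
  Janiszewski's theorem a point off a plane theta is separated from exactly one of the three paths
  by the cycle formed by the other two. If no cycle separates vertices, this implies that a theta
  whose three paths all have interior vertices spans the graph, that its branch vertices are not
  adjacent, and that every \<open>K\<^sub>4\<close> spans the graph. From here on only these three facts matter.

  If there is no such theta and no \<open>K\<^sub>4\<close>, then the vertices have a cyclic order without crossing
  edges, obtained by gluing along separations of order at most one; in a nonseparable graph a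
  longest cycle is Hamiltonian and none of its chords cross. Drawing straight chords of a circle
  shows that the graph is outerplanar. A \<open>K\<^sub>4\<close> is a wheel. Finally, if a spanning theta exists, an edge
  outside it joins the interiors of two different paths. Each such chord creates further thetas, and
  since all of them must span, the chords occur only in the positions of a wheel or of a prism.\<close>

subsection \<open>Paths and thetas in graphs\<close>

text \<open>Edges are arbitrary arcs and faces are never introduced. All that is extracted from the
  plane about thetas is \<open>theta_faces\<close>, which speaks of arbitrary points. Hence a point
  inside an edge can stand in for a vertex; this is how a third or fourth object is found on each
  side of a cycle when the branch vertices are adjacent or a K4 is present. The three facts kept
  from the drawing exclude a vertex beside a subdivided K_{2,3}, a subdivided K_{2,3} with adjacent
  branch vertices, and a vertex beside a K4. K_{2,3} and K4 are the obstructions to outerplanarity,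
  which is why their absence yields a noncrossing order. The analysis of a spanning theta rests on
  one device: out of its paths and some chords another fat theta is built that misses a known
  vertex, against spanning. The interiors of the paths are therefore explicit lists, which can be
  cut at the end of a chord, reversed and recombined.\<close>

fun path_edges :: "'v list \<Rightarrow> 'v set set" where
  "path_edges (x # y # zs) = insert {x, y} (path_edges (y # zs))"
| "path_edges _ = {}"

lemma path_edges_Cons: "path_edges (x # xs) = (if xs = [] then {} else insert {x, hd xs} (path_edges xs))"
  by (cases xs) auto

lemma path_edges_append:
  "path_edges (xs @ ys) = path_edges xs \<union> path_edges ys \<union> (if xs = [] \<or> ys = [] then {} else {{last xs, hd ys}})"
  by (induction xs rule: path_edges.induct) (auto simp: path_edges_Cons)

lemma path_edges_rev: "path_edges (rev xs) = path_edges xs"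
  by (induction xs) (auto simp: path_edges_Cons path_edges_append last_rev insert_commute)

lemma path_edges_subset: "e \<in> path_edges xs \<Longrightarrow> e \<subseteq> set xs"
  by (induction xs rule: path_edges.induct) auto

lemma path_edges_cover: "2 \<le> length xs \<Longrightarrow> v \<in> set xs \<Longrightarrow> \<exists>e\<in>path_edges xs. v \<in> e"
proof (induction xs rule: path_edges.induct)
  case (1 x y zs)
  then show ?case by (cases "zs = []") (auto simp: Suc_le_eq)
qed auto

lemma path_edges_conv_nth: "path_edges xs = {{xs ! i, xs ! Suc i} | i. Suc i < length xs}"
proof (induction xs rule: path_edges.induct)
  case (1 x y zs)
  have "{{(x # y # zs) ! i, (x # y # zs) ! Suc i} | i. Suc i < length (x # y # zs)} =
    insert {x, y} {{(y # zs) ! i, (y # zs) ! Suc i} | i. Suc i < length (y # zs)}" (is "?L = ?R")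
  proof
    show "?L \<subseteq> ?R"
    proof
      fix e assume "e \<in> ?L"
      then obtain i where "Suc i < length (x # y # zs)" "e = {(x # y # zs) ! i, (x # y # zs) ! Suc i}"
        by blast
      then show "e \<in> ?R" by (cases i) auto
    qed
    show "?R \<subseteq> ?L" by (auto intro: exI[of _ 0] exI[of _ "Suc _"])
  qed
  then show ?case using 1 by simp
qed auto

lemma cycle_edges_conv_path_edges:
  assumes "vs \<noteq> []"
  shows "cycle_edges vs = path_edges (vs @ [hd vs])"
proof -
  have "{(vs @ [hd vs]) ! i, (vs @ [hd vs]) ! Suc i} = {vs ! i, vs ! (Suc i mod length vs)}"
    if "i < length vs" for i
    using that assms by (cases "Suc i = length vs") (auto simp: nth_append hd_conv_nth)
  then show ?thesis
    unfolding cycle_edges_def path_edges_conv_nth by fastforce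
qed

lemma ends_notin_path_edges:
  assumes "distinct (x # P @ [y])" "P \<noteq> []"
  shows "{x, y} \<notin> path_edges (x # P @ [y])"
  using assms path_edges_subset[of "{x, y}" "P @ [y]"]
  by (cases P) (auto simp: path_edges_Cons doubleton_eq_iff)

text \<open>In a theta with branch vertices \<open>x\<close> and \<open>y\<close>, the lists \<open>P\<close>, \<open>Q\<close>, \<open>R\<close> hold the interior
  vertices of its three paths. A fat theta is a subdivision of \<open>K\<^sub>2\<^sub>,\<^sub>3\<close>.\<close>

definition theta :: "'v set set \<Rightarrow> 'v \<Rightarrow> 'v \<Rightarrow> 'v list \<Rightarrow> 'v list \<Rightarrow> 'v list \<Rightarrow> bool" where
  "theta E x y P Q R \<longleftrightarrow> distinct (x # y # P @ Q @ R) \<and>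
     path_edges (x # P @ [y]) \<subseteq> E \<and> path_edges (x # Q @ [y]) \<subseteq> E \<and> path_edges (x # R @ [y]) \<subseteq> E"

definition fat_theta :: "'v set set \<Rightarrow> 'v \<Rightarrow> 'v \<Rightarrow> 'v list \<Rightarrow> 'v list \<Rightarrow> 'v list \<Rightarrow> bool" where
  "fat_theta E x y P Q R \<longleftrightarrow> theta E x y P Q R \<and> P \<noteq> [] \<and> Q \<noteq> [] \<and> R \<noteq> []"

text \<open>The list is a cyclic order written from an arbitrary starting point: two chords of a
  circle cross exactly if their ends alternate, and this does not change under rotation.\<close>

definition noncrossing :: "'v set set \<Rightarrow> 'v list \<Rightarrow> bool" where
  "noncrossing E vs \<longleftrightarrow> (\<forall>a b c d. a < b \<longrightarrow> b < c \<longrightarrow> c < d \<longrightarrow> d < length vs \<longrightarrow>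
     {vs ! a, vs ! c} \<in> E \<longrightarrow> {vs ! b, vs ! d} \<notin> E)"

subsection \<open>Theta curves in the plane\<close>

lemma Jordan_arcs:
  fixes c1 c2 :: "real \<Rightarrow> complex"
  assumes "arc c1" "arc c2" "pathstart c1 = a" "pathfinish c1 = b"
    "pathstart c2 = a" "pathfinish c2 = b" "path_image c1 \<inter> path_image c2 = {a, b}"
  defines "S \<equiv> path_image c1 \<union> path_image c2"
  shows "inside S \<noteq> {}" "connected (inside S)" "outside S \<noteq> {}" "connected (outside S)"
    "frontier (inside S) = S" "frontier (outside S) = S"
proof -
  let ?c = "c1 +++ reversepath c2"
  have "simple_path ?c"
    using assms by (intro simple_path_join_loop) (auto simp: arc_reversepath)
  moreover have "pathfinish ?c = pathstart ?c" using assms by simp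
  moreover have "path_image ?c = S"
    using assms by (simp add: path_image_join)
  ultimately show "inside S \<noteq> {}" "connected (inside S)" "outside S \<noteq> {}" "connected (outside S)"
    "frontier (inside S) = S" "frontier (outside S) = S"
    using Jordan_inside_outside[of ?c] by auto
qed

text \<open>Pigeonhole: the complement of a closed Jordan curve has only two components. Three
  pairwise separated points give the contradiction for K4.\<close>

lemma Jordan_arcs_two_sides:
  fixes c1 c2 :: "real \<Rightarrow> complex"
  assumes "arc c1" "arc c2" "pathstart c1 = a" "pathfinish c1 = b"
    "pathstart c2 = a" "pathfinish c2 = b" "path_image c1 \<inter> path_image c2 = {a, b}"
  defines "S \<equiv> path_image c1 \<union> path_image c2"
  assumes "u \<notin> S" "v \<notin> S" "w \<notin> S"
  shows "connected_component (- S) u v \<or> connected_component (- S) u w \<or> connected_component (- S) v w"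
proof -
  note J = Jordan_arcs[OF assms(1-7), folded S_def]
  have "inside S \<subseteq> - S" "outside S \<subseteq> - S" "\<And>t. t \<notin> S \<Longrightarrow> t \<in> inside S \<or> t \<in> outside S"
    using inside_Un_outside[of S] by blast+
  then show ?thesis
    using J(2,4) assms(9-11) unfolding connected_component_def by metis
qed

text \<open>The side of the cycle \<open>c1 \<union> c2\<close> that avoids \<open>c3\<close> is connected, disjoint from the whole theta and
  accumulates at \<open>z2\<close>.\<close>

lemma theta_opposite:
  fixes c1 c2 c3 :: "real \<Rightarrow> complex"
  assumes arcs: "arc c1" "arc c2" "arc c3"
    and ends: "pathstart c1 = a" "pathfinish c1 = b" "pathstart c2 = a" "pathfinish c2 = b"
      "pathstart c3 = a" "pathfinish c3 = b"
    and meet: "path_image c1 \<inter> path_image c2 = {a, b}" "path_image c1 \<inter> path_image c3 = {a, b}"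
      "path_image c2 \<inter> path_image c3 = {a, b}"
    and z2: "z2 \<in> path_image c2 - {a, b}" and z3: "z3 \<in> path_image c3 - {a, b}"
    and w: "w \<notin> path_image c1 \<union> path_image c2"
    and sep: "\<not> connected_component (- (path_image c1 \<union> path_image c2)) w z3"
  shows "connected_component (- (path_image c1 \<union> path_image c3)) w z2"
proof -
  define S where "S = path_image c1 \<union> path_image c2"
  note J = Jordan_arcs[OF arcs(1,2) ends(1-4) meet(1), folded S_def]
  obtain F where F: "w \<in> F" "connected F" "frontier F = S" "F \<subseteq> - S"
  proof (cases "w \<in> inside S")
    case True
    then show thesis using that[of "inside S"] J inside_Un_outside[of S] by blast
  next
    case False
    then have "w \<in> outside S" using w inside_Un_outside[of S] unfolding S_def by blast
    then show thesis using that[of "outside S"] J inside_Un_outside[of S] by blast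
  qed
  let ?A = "path_image c3 - {a, b}"
  have conA: "connected ?A"
    using connected_simple_path_endless[of c3] arcs ends by (simp add: arc_imp_simple_path)
  have AS: "?A \<subseteq> - S" using meet by (auto simp: S_def)
  \<comment> \<open>The open arc of \<open>c3\<close> is connected and misses \<open>S\<close>. If
    it met the side \<open>F\<close> of \<open>w\<close>, then \<open>w\<close> could be joined to
    \<open>z3\<close>.\<close>
  have "F \<inter> ?A = {}"
  proof (rule ccontr)
    assume "F \<inter> ?A \<noteq> {}"
    then obtain t where "t \<in> F" "t \<in> ?A" by auto
    then have "connected_component (- S) w t" "connected_component (- S) t z3"
      using F conA AS z3 by (auto simp: connected_component_def intro: exI[of _ F] exI[of _ ?A])
    then show False using sep connected_component_trans unfolding S_def by blast
  qed
  moreover have "a \<in> S" "b \<in> S" using meet by (auto simp: S_def)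
  ultimately have FC: "F \<subseteq> - (path_image c1 \<union> path_image c3)"
    using F(4) by (auto simp: S_def)
  have "open (- (path_image c1 \<union> path_image c3))"
    using arcs by (intro open_Compl closed_Un closed_arc_image)
  moreover have "z2 \<in> - (path_image c1 \<union> path_image c3)" using z2 meet by auto
  ultimately obtain e where e: "e > 0" "ball z2 e \<subseteq> - (path_image c1 \<union> path_image c3)"
    by (meson openE)
  \<comment> \<open>Every point of \<open>S\<close> is a frontier point of \<open>F\<close>, so the
    small ball around \<open>z2\<close> contains a point of \<open>F\<close> and links
    \<open>F\<close> to \<open>z2\<close>.\<close>
  have "z2 \<in> closure F" using z2 F(3) by (auto simp: S_def frontier_def)
  then obtain f where f: "f \<in> F" "f \<in> ball z2 e"
    using e(1) by (metis closure_approachable dist_commute mem_ball)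
  have "connected_component (- (path_image c1 \<union> path_image c3)) w f"
    using F FC f by (auto simp: connected_component_def)
  moreover have "connected_component (- (path_image c1 \<union> path_image c3)) f z2"
    unfolding connected_component_def using e f by (intro exI[of _ "ball z2 e"]) auto
  ultimately show ?thesis by (rule connected_component_trans)
qed

text \<open>Each of the three regions of a theta curve is bounded by two of the arcs, and
  \<open>w\<close> lies in one region. At most one separation occurs by
  \<open>theta_opposite\<close>. At least one occurs by Janiszewski's theorem, since two of the
  three cycles meet in a single arc, which is connected.\<close>

lemma theta_faces:
  fixes c1 c2 c3 :: "real \<Rightarrow> complex"
  assumes arcs: "arc c1" "arc c2" "arc c3"
    and ends: "pathstart c1 = a" "pathfinish c1 = b" "pathstart c2 = a" "pathfinish c2 = b"
      "pathstart c3 = a" "pathfinish c3 = b"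
    and meet: "path_image c1 \<inter> path_image c2 = {a, b}" "path_image c1 \<inter> path_image c3 = {a, b}"
      "path_image c2 \<inter> path_image c3 = {a, b}"
    and z: "z1 \<in> path_image c1 - {a, b}" "z2 \<in> path_image c2 - {a, b}" "z3 \<in> path_image c3 - {a, b}"
    and w: "w \<notin> path_image c1 \<union> path_image c2 \<union> path_image c3"
  defines "same S \<equiv> connected_component (- S)"
  defines "C12 \<equiv> path_image c1 \<union> path_image c2"
    and "C13 \<equiv> path_image c1 \<union> path_image c3"
    and "C23 \<equiv> path_image c2 \<union> path_image c3"
  shows "\<not> same C12 w z3 \<and> same C13 w z2 \<and> same C23 w z1 \<or>
    \<not> same C13 w z2 \<and> same C12 w z3 \<and> same C23 w z1 \<or>
    \<not> same C23 w z1 \<and> same C12 w z3 \<and> same C13 w z2"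
proof -
  have meet': "path_image c2 \<inter> path_image c1 = {a, b}" "path_image c3 \<inter> path_image c1 = {a, b}"
      "path_image c3 \<inter> path_image c2 = {a, b}"
    using meet by blast+
  note opp = theta_opposite[where a = a and b = b]
  have opp12: "same C13 v z2 \<and> same C23 v z1" if "v \<notin> C12" "\<not> same C12 v z3" for v
    using opp[OF arcs(1,2,3) ends meet z(2,3), of v]
      opp[OF arcs(2,1,3) ends(3,4,1,2,5,6) meet'(1) meet(3,2) z(1,3), of v] that
    unfolding same_def by (simp add: C12_def C13_def C23_def Un_commute)
  have opp13: "same C12 v z3 \<and> same C23 v z1" if "v \<notin> C13" "\<not> same C13 v z2" for v
    using opp[OF arcs(1,3,2) ends(1,2,5,6,3,4) meet(2,1) meet'(3) z(3,2), of v]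
      opp[OF arcs(3,1,2) ends(5,6,1,2,3,4) meet'(2,3) meet(1) z(1,2), of v] that
    unfolding same_def by (simp add: C12_def C13_def C23_def Un_commute)
  have opp23: "same C12 v z3 \<and> same C13 v z2" if "v \<notin> C23" "\<not> same C23 v z1" for v
    using opp[OF arcs(2,3,1) ends(3,4,5,6,1,2) meet(3) meet'(1,2) z(3,1), of v]
      opp[OF arcs(3,2,1) ends(5,6,3,4,1,2) meet'(3,2,1) z(2,1), of v] that
    unfolding same_def by (simp add: C12_def C13_def C23_def Un_commute)
  have "\<not> (same C12 w z3 \<and> same C13 w z2 \<and> same C23 w z1)"
  proof
    assume all: "same C12 w z3 \<and> same C13 w z2 \<and> same C23 w z1"
    note J = Jordan_arcs[OF arcs(1,2) ends(1-4) meet(1), folded C12_def]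
    \<comment> \<open>\<open>u\<close> is taken from the side of \<open>C12\<close> that does not
      contain \<open>z3\<close>. The other two cycles then separate \<open>u\<close> from nothing
      relevant, so they do not separate it from \<open>w\<close>.\<close>
    obtain u where u: "u \<notin> C12" "\<not> same C12 u z3"
    proof (cases "z3 \<in> inside C12")
      case True
      obtain u where u: "u \<in> outside C12" using J by auto
      have "\<not> same C12 u z3"
        unfolding same_def using True u
        by (metis connected_component_sym inside_same_component inside_Int_outside disjoint_iff)
      then show thesis using that u by (metis outside_no_overlap disjoint_iff)
    next
      case False
      obtain u where u: "u \<in> inside C12" using J by auto
      have "\<not> same C12 u z3"
        unfolding same_def using False u by (metis inside_same_component)
      then show thesis using that u by (metis inside_no_overlap disjoint_iff)
    qed
    have "same C13 w u" "same C23 w u"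
      using all opp12[OF u] unfolding same_def
      by (meson connected_component_sym connected_component_trans)+
    moreover have "connected (C13 \<inter> C23)"
    proof -
      have "C13 \<inter> C23 = path_image c3" using meet by (auto simp: C13_def C23_def)
      then show ?thesis using arcs by (simp add: connected_arc_image)
    qed
    moreover have "compact C13" "closed C23"
      using arcs unfolding C13_def C23_def by (auto simp: compact_Un compact_arc_image closed_Un closed_arc_image)
    \<comment> \<open>Off both cycles \<open>w\<close> and \<open>u\<close> can now be joined, and
      \<open>C12\<close> is contained in their union. So \<open>C12\<close> does not separate
      \<open>w\<close> from \<open>u\<close>, although \<open>w\<close> is on the side of
      \<open>z3\<close> and \<open>u\<close> is not.\<close>
    ultimately have "connected_component (- (C13 \<union> C23)) w u"
      unfolding same_def by (intro Janiszewski) auto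
    then have "same C12 w u"
      unfolding same_def by (rule connected_component_of_subset) (auto simp: C12_def C13_def C23_def)
    then show False using u all unfolding same_def
      by (meson connected_component_sym connected_component_trans)
  qed
  moreover have "w \<notin> C12" "w \<notin> C13" "w \<notin> C23" using w by (auto simp: C12_def C13_def C23_def)
  ultimately show ?thesis using opp12 opp13 opp23 by blast
qed

subsection \<open>Thetas in a drawing without separating cycles\<close>

locale nonseparating_drawing =
  fixes G :: "'v graph" and p :: "'v \<Rightarrow> complex" and \<gamma> :: "'v set \<Rightarrow> real \<Rightarrow> complex"
  assumes simple: "finite_simple_graph G"
    and drawing: "planar_drawing G p \<gamma>"
    and nonseparating: "\<not> separating_cycle G p \<gamma> vs"
begin

definition curve :: "'v list \<Rightarrow> complex set" where
  "curve xs = (\<Union>e\<in>path_edges xs. path_image (\<gamma> e))"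

lemma p_eq_iff: "u \<in> verts G \<Longrightarrow> v \<in> verts G \<Longrightarrow> p u = p v \<longleftrightarrow> u = v"
  using drawing by (auto simp: planar_drawing_def inj_on_def)

lemma edge_verts: "e \<in> edges G \<Longrightarrow> e \<subseteq> verts G"
  using simple by (auto simp: finite_simple_graph_def)

lemma path_edges_verts: "path_edges xs \<subseteq> edges G \<Longrightarrow> 2 \<le> length xs \<Longrightarrow> set xs \<subseteq> verts G"
  using path_edges_cover[of xs] edge_verts by blast

lemma edge_arc:
  assumes "{x, y} \<in> edges G"
  obtains g where "arc g" "pathstart g = p x" "pathfinish g = p y"
    "path_image g = path_image (\<gamma> {x, y})"
proof -
  let ?g = "\<gamma> {x, y}"
  have g: "arc ?g" "{pathstart ?g, pathfinish ?g} = {p x, p y}"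
    using assms drawing by (auto simp: planar_drawing_def)
  show thesis
  proof (cases "pathstart ?g = p x \<and> pathfinish ?g = p y")
    case True
    then show thesis using that[of ?g] g by auto
  next
    case False
    then have "pathstart ?g = p y \<and> pathfinish ?g = p x"
      using g by (metis doubleton_eq_iff)
    then show thesis using that[of "reversepath ?g"] g by (auto simp: arc_reversepath)
  qed
qed

lemma edge_image_Int:
  "e \<in> edges G \<Longrightarrow> e' \<in> edges G \<Longrightarrow> e \<noteq> e' \<Longrightarrow> path_image (\<gamma> e) \<inter> path_image (\<gamma> e') \<subseteq> p ` (e \<inter> e')"
  using drawing by (auto simp: planar_drawing_def)

lemma vertex_in_edge_iff:
  "e \<in> edges G \<Longrightarrow> v \<in> verts G \<Longrightarrow> p v \<in> path_image (\<gamma> e) \<longleftrightarrow> v \<in> e"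
proof -
  assume e: "e \<in> edges G" "v \<in> verts G"
  then have "path_image (\<gamma> e) \<inter> p ` verts G = p ` e"
    using drawing by (auto simp: planar_drawing_def)
  then have "p v \<in> path_image (\<gamma> e) \<longleftrightarrow> p v \<in> p ` e" using e by blast
  then show ?thesis using e edge_verts[OF e(1)] p_eq_iff by auto
qed

lemma vertex_in_curve_iff:
  assumes "path_edges xs \<subseteq> edges G" "2 \<le> length xs" "v \<in> verts G"
  shows "p v \<in> curve xs \<longleftrightarrow> v \<in> set xs"
proof -
  have "p v \<in> curve xs \<longleftrightarrow> (\<exists>e\<in>path_edges xs. v \<in> e)"
    using assms vertex_in_edge_iff by (auto simp: curve_def)
  also have "\<dots> \<longleftrightarrow> v \<in> set xs"
    using path_edges_cover[of xs v] path_edges_subset assms by blast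
  finally show ?thesis .
qed

lemma curve_Int:
  assumes "path_edges xs \<subseteq> edges G" "path_edges ys \<subseteq> edges G" "path_edges xs \<inter> path_edges ys = {}"
  shows "curve xs \<inter> curve ys \<subseteq> p ` (set xs \<inter> set ys)"
proof
  fix z assume "z \<in> curve xs \<inter> curve ys"
  then obtain e e' where e: "e \<in> path_edges xs" "e' \<in> path_edges ys" "z \<in> path_image (\<gamma> e) \<inter> path_image (\<gamma> e')"
    by (auto simp: curve_def)
  then have "e \<noteq> e'" using assms(3) by auto
  then have "z \<in> p ` (e \<inter> e')" using edge_image_Int[of e e'] e assms by blast
  then show "z \<in> p ` (set xs \<inter> set ys)" using path_edges_subset e by blast
qed

lemma curve_arc:
  assumes "distinct xs" "2 \<le> length xs" "path_edges xs \<subseteq> edges G"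
  shows "\<exists>g. arc g \<and> pathstart g = p (hd xs) \<and> pathfinish g = p (last xs) \<and> path_image g = curve xs"
  using assms
proof (induction xs rule: path_edges.induct)
  case (1 x y zs)
  then have "{x, y} \<in> edges G" by simp
  then obtain h where h: "arc h" "pathstart h = p x" "pathfinish h = p y"
      "path_image h = path_image (\<gamma> {x, y})"
    by (rule edge_arc)
  show ?case
  proof (cases "zs = []")
    case True
    then show ?thesis using h by (auto simp: curve_def)
  next
    case False
    then obtain g where g: "arc g" "pathstart g = p y" "pathfinish g = p (last (y # zs))"
        "path_image g = curve (y # zs)"
      using 1 by (cases zs) auto
    have "path_image h = curve [x, y]" using h by (simp add: curve_def)
    moreover have "{x, y} \<notin> path_edges (y # zs)"
      using 1(2) path_edges_subset[of "{x, y}" "y # zs"] by auto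
    ultimately have "path_image h \<inter> path_image g \<subseteq> {p y}"
      using curve_Int[of "[x, y]" "y # zs"] 1 g by auto
    then have "arc (h +++ g)" using h g by (intro arc_join) auto
    moreover have "path_image (h +++ g) = curve (x # y # zs)"
      using h g by (simp add: path_image_join curve_def)
    ultimately show ?thesis using h g by (intro exI[of _ "h +++ g"]) auto
  qed
qed auto

text \<open>The paths share only \<open>x\<close> and \<open>y\<close>, so a common edge would be
  the edge \<open>{x, y}\<close>, and a path with an interior vertex does not use it.\<close>

lemma theta_path_edges_disjoint:
  assumes "distinct (x # y # P @ Q)" "P \<noteq> [] \<or> Q \<noteq> []" "path_edges (x # P @ [y]) \<subseteq> edges G"
  shows "path_edges (x # P @ [y]) \<inter> path_edges (x # Q @ [y]) = {}"
proof (rule ccontr)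
  assume "path_edges (x # P @ [y]) \<inter> path_edges (x # Q @ [y]) \<noteq> {}"
  then obtain e where e: "e \<in> path_edges (x # P @ [y])" "e \<in> path_edges (x # Q @ [y])" by auto
  then have "e \<subseteq> set (x # P @ [y]) \<inter> set (x # Q @ [y])" using path_edges_subset by blast
  also have "\<dots> \<subseteq> {x, y}" using assms by auto
  finally have "e \<subseteq> {x, y}" .
  moreover have "card e = 2" using e assms simple by (auto simp: finite_simple_graph_def)
  moreover have "card {x, y} = 2" using assms by auto
  ultimately have "e = {x, y}" by (metis card_subset_eq finite.emptyI finite_insert)
  then show False using e assms ends_notin_path_edges[of x P y] ends_notin_path_edges[of x Q y] by auto
qed

lemma theta_curve_Int:
  assumes "distinct (x # y # P @ Q)" "P \<noteq> [] \<or> Q \<noteq> []"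
    "path_edges (x # P @ [y]) \<subseteq> edges G" "path_edges (x # Q @ [y]) \<subseteq> edges G"
  shows "curve (x # P @ [y]) \<inter> curve (x # Q @ [y]) = {p x, p y}"
proof
  have "set (x # P @ [y]) \<inter> set (x # Q @ [y]) \<subseteq> {x, y}" using assms(1) by auto
  then show "curve (x # P @ [y]) \<inter> curve (x # Q @ [y]) \<subseteq> {p x, p y}"
    using curve_Int[OF assms(3,4) theta_path_edges_disjoint[OF assms(1-3)]] by blast
  show "{p x, p y} \<subseteq> curve (x # P @ [y]) \<inter> curve (x # Q @ [y])"
    using vertex_in_curve_iff[OF assms(3)] vertex_in_curve_iff[OF assms(4)]
      path_edges_verts[OF assms(3)] by auto
qed

lemma theta_arcs:
  assumes "distinct (x # P @ [y])" "path_edges (x # P @ [y]) \<subseteq> edges G"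
  obtains g where "arc g" "pathstart g = p x" "pathfinish g = p y" "path_image g = curve (x # P @ [y])"
  using curve_arc[of "x # P @ [y]"] assms by auto

text \<open>At most one of the three paths may be a single edge, and the points need not be
  vertices. Both freedoms are used below, with points inside an edge.\<close>

lemma theta_drawing_faces:
  assumes "theta (edges G) x y P Q R"
    and "P \<noteq> [] \<or> Q \<noteq> []" "P \<noteq> [] \<or> R \<noteq> []" "Q \<noteq> [] \<or> R \<noteq> []"
  defines "c1 \<equiv> curve (x # P @ [y])" and "c2 \<equiv> curve (x # Q @ [y])" and "c3 \<equiv> curve (x # R @ [y])"
  assumes "z1 \<in> c1 - {p x, p y}" "z2 \<in> c2 - {p x, p y}" "z3 \<in> c3 - {p x, p y}"
    and "w \<notin> c1 \<union> c2 \<union> c3"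
  defines "same S \<equiv> connected_component (- S)"
  shows "\<not> same (c1 \<union> c2) w z3 \<and> same (c1 \<union> c3) w z2 \<and> same (c2 \<union> c3) w z1 \<or>
    \<not> same (c1 \<union> c3) w z2 \<and> same (c1 \<union> c2) w z3 \<and> same (c2 \<union> c3) w z1 \<or>
    \<not> same (c2 \<union> c3) w z1 \<and> same (c1 \<union> c2) w z3 \<and> same (c1 \<union> c3) w z2"
proof -
  have th: "distinct (x # P @ [y])" "distinct (x # Q @ [y])" "distinct (x # R @ [y])"
    "distinct (x # y # P @ Q)" "distinct (x # y # P @ R)" "distinct (x # y # Q @ R)"
    "path_edges (x # P @ [y]) \<subseteq> edges G" "path_edges (x # Q @ [y]) \<subseteq> edges G" "path_edges (x # R @ [y]) \<subseteq> edges G"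
    using assms(1) by (auto simp: theta_def)
  obtain g1 where g1: "arc g1" "pathstart g1 = p x" "pathfinish g1 = p y" "path_image g1 = c1"
    using theta_arcs[OF th(1,7)] unfolding c1_def by metis
  obtain g2 where g2: "arc g2" "pathstart g2 = p x" "pathfinish g2 = p y" "path_image g2 = c2"
    using theta_arcs[OF th(2,8)] unfolding c2_def by metis
  obtain g3 where g3: "arc g3" "pathstart g3 = p x" "pathfinish g3 = p y" "path_image g3 = c3"
    using theta_arcs[OF th(3,9)] unfolding c3_def by metis
  have meet: "c1 \<inter> c2 = {p x, p y}" "c1 \<inter> c3 = {p x, p y}" "c2 \<inter> c3 = {p x, p y}"
    using theta_curve_Int th assms(2-4) unfolding c1_def c2_def c3_def by metis+
  show ?thesis
    using theta_faces[OF g1(1) g2(1) g3(1) g1(2,3) g2(2,3) g3(2,3), unfolded g1(4) g2(4) g3(4), OF meet]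
      assms(8-11) unfolding same_def by metis
qed

text \<open>Here the absence of separating cycles enters: both vertices lie inside or both outside
  the cycle formed by the two paths, and either side is connected by the Jordan curve
  theorem.\<close>

lemma same_side:
  assumes "distinct (x # y # P @ Q)" "P \<noteq> [] \<or> Q \<noteq> []"
    "path_edges (x # P @ [y]) \<subseteq> edges G" "path_edges (x # Q @ [y]) \<subseteq> edges G"
    and "u \<in> verts G - ({x, y} \<union> set P \<union> set Q)" "v \<in> verts G - ({x, y} \<union> set P \<union> set Q)"
  shows "connected_component (- (curve (x # P @ [y]) \<union> curve (x # Q @ [y]))) (p u) (p v)"
proof -
  define S where "S = curve (x # P @ [y]) \<union> curve (x # Q @ [y])"
  let ?vs = "x # P @ y # rev Q"
  have "distinct (x # P @ [y])" "distinct (x # Q @ [y])" using assms by auto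
  then obtain g1 g2 where g: "arc g1" "pathstart g1 = p x" "pathfinish g1 = p y"
      "path_image g1 = curve (x # P @ [y])" "arc g2" "pathstart g2 = p x" "pathfinish g2 = p y"
      "path_image g2 = curve (x # Q @ [y])"
    using theta_arcs assms(3,4) by metis
  note J = Jordan_arcs[OF g(1,5,2,3,6,7), unfolded g(4,8), OF theta_curve_Int[OF assms(1-4)], folded S_def]
  have "path_edges (y # rev Q @ [x]) = path_edges (x # Q @ [y])"
    using path_edges_rev[of "x # Q @ [y]"] by simp
  then have ce: "cycle_edges ?vs = path_edges (x # P @ [y]) \<union> path_edges (x # Q @ [y])"
    using path_edges_append[of "x # P @ [y]" "rev Q @ [x]"] path_edges_Cons[of y "rev Q @ [x]"]
    by (subst cycle_edges_conv_path_edges) auto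
  then have S: "cycle_curve \<gamma> ?vs = S" by (simp add: cycle_curve_def S_def curve_def)
  have "length ?vs \<ge> 3" using assms(2) by (auto simp: Suc_le_eq)
  moreover have "set ?vs \<subseteq> verts G"
    using path_edges_verts[OF assms(3)] path_edges_verts[OF assms(4)] by auto
  ultimately have "cycle_in G ?vs" using assms ce by (auto simp: cycle_in_def)
  then have ns: "\<not> (p a \<in> inside S \<and> p b \<in> outside S)" if "a \<in> verts G" "b \<in> verts G" for a b
    using that nonseparating[of ?vs] by (auto simp: separating_cycle_def S)
  have "p a \<in> inside S \<or> p a \<in> outside S" if "a \<in> verts G - ({x, y} \<union> set P \<union> set Q)" for a
  proof -
    have "p a \<notin> S" using that vertex_in_curve_iff assms(3,4) unfolding S_def by auto
    then show ?thesis using inside_Un_outside[of S] by blast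
  qed
  then have "p u \<in> inside S \<and> p v \<in> inside S \<or> p u \<in> outside S \<and> p v \<in> outside S"
    using ns assms(5,6) by blast
  moreover have "inside S \<subseteq> - S" "outside S \<subseteq> - S" using inside_Un_outside[of S] by blast+
  ultimately show ?thesis
    using J unfolding S_def[symmetric] connected_component_def by blast
qed

text \<open>\<open>m\<close> is the midpoint of the arc in its parametrization. If \<open>T\<close>
  meets the arc at most in one end, the half-open arc without that end connects \<open>m\<close> to
  the other end off \<open>T\<close>.\<close>

lemma edge_interior:
  assumes "{x, y} \<in> edges G" "x \<noteq> y"
  obtains m where "m \<in> path_image (\<gamma> {x, y})" "m \<noteq> p x" "m \<noteq> p y"
    "\<And>T. T \<inter> path_image (\<gamma> {x, y}) \<subseteq> {p x} \<Longrightarrow> connected_component (- T) m (p y)"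
    "\<And>T. T \<inter> path_image (\<gamma> {x, y}) \<subseteq> {p y} \<Longrightarrow> connected_component (- T) m (p x)"
proof -
  obtain g where g: "arc g" "pathstart g = p x" "pathfinish g = p y"
    "path_image g = path_image (\<gamma> {x, y})" using edge_arc[OF assms(1)] .
  have inj: "inj_on g {0..1}" and cont: "continuous_on {0..1} g"
    using g by (auto simp: arc_def path_def)
  let ?m = "g (1/2)"
  have ends: "g 0 = p x" "g 1 = p y" using g by (auto simp: pathstart_def pathfinish_def)
  have img: "g t \<in> path_image (\<gamma> {x, y})" if "t \<in> {0..1}" for t
    using that unfolding g(4)[symmetric] by (auto simp: path_image_def)
  have nx: "g t \<noteq> p x" if "t \<in> {0<..1}" for t
    using inj_onD[OF inj, of t 0] that ends by auto
  have ny: "g t \<noteq> p y" if "t \<in> {0..<1}" for t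
    using inj_onD[OF inj, of t 1] that ends by auto
  show thesis
  proof
    show "?m \<in> path_image (\<gamma> {x, y})" "?m \<noteq> p x" "?m \<noteq> p y"
      using img nx ny by auto
  next
    fix T assume T: "T \<inter> path_image (\<gamma> {x, y}) \<subseteq> {p x}"
    have "connected (g ` {0<..1})"
      by (intro connected_continuous_image continuous_on_subset[OF cont]) auto
    moreover have "g ` {0<..1} \<subseteq> - T" using T img nx by fastforce
    ultimately show "connected_component (- T) ?m (p y)"
      unfolding connected_component_def ends[symmetric] by (intro exI[of _ "g ` {0<..1}"]) auto
  next
    fix T assume T: "T \<inter> path_image (\<gamma> {x, y}) \<subseteq> {p y}"
    have "connected (g ` {0..<1})"
      by (intro connected_continuous_image continuous_on_subset[OF cont]) auto
    moreover have "g ` {0..<1} \<subseteq> - T" using T img ny by fastforce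
    ultimately show "connected_component (- T) ?m (p x)"
      unfolding connected_component_def ends[symmetric] by (intro exI[of _ "g ` {0..<1}"]) auto
  qed
qed

lemma theta_perm:
  "theta E x y P Q R \<Longrightarrow> theta E x y Q P R" "theta E x y P Q R \<Longrightarrow> theta E x y P R Q"
  by (auto simp: theta_def)

lemma interior_vertex:
  assumes "theta (edges G) x y P Q R" "a \<in> set P"
  shows "a \<in> verts G" "p a \<in> curve (x # P @ [y]) - {p x, p y}"
    "p a \<notin> curve (x # Q @ [y])" "p a \<notin> curve (x # R @ [y])"
proof -
  have pe: "path_edges (x # P @ [y]) \<subseteq> edges G" "path_edges (x # Q @ [y]) \<subseteq> edges G"
     "path_edges (x # R @ [y]) \<subseteq> edges G" and d: "distinct (x # y # P @ Q @ R)"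
    using assms by (auto simp: theta_def)
  have vs: "x \<in> verts G" "y \<in> verts G" "a \<in> verts G" using path_edges_verts[OF pe(1)] assms(2) by auto
  show "a \<in> verts G" by fact
  show "p a \<in> curve (x # P @ [y]) - {p x, p y}"
    using vs d assms(2) vertex_in_curve_iff[OF pe(1)] p_eq_iff by auto
  show "p a \<notin> curve (x # Q @ [y])" "p a \<notin> curve (x # R @ [y])"
    using vs d assms(2) vertex_in_curve_iff[OF pe(2)] vertex_in_curve_iff[OF pe(3)] by auto
qed

text \<open>A vertex \<open>u\<close> off the theta would be separated from one path by the other
  two. But each path has an interior vertex, and no cycle of the theta separates that vertex from
  \<open>u\<close>.\<close>

theorem fat_theta_spanning:
  assumes "fat_theta (edges G) x y P Q R"
  shows "verts G = {x, y} \<union> set P \<union> set Q \<union> set R"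
proof (rule ccontr)
  assume neq: "verts G \<noteq> {x, y} \<union> set P \<union> set Q \<union> set R"
  have th: "theta (edges G) x y P Q R" and ne: "P \<noteq> []" "Q \<noteq> []" "R \<noteq> []"
    using assms by (auto simp: fat_theta_def)
  have pe: "path_edges (x # P @ [y]) \<subseteq> edges G" "path_edges (x # Q @ [y]) \<subseteq> edges G"
     "path_edges (x # R @ [y]) \<subseteq> edges G" and d: "distinct (x # y # P @ Q @ R)"
    using th by (auto simp: theta_def)
  have sub: "{x, y} \<union> set P \<union> set Q \<union> set R \<subseteq> verts G"
    using path_edges_verts[OF pe(1)] path_edges_verts[OF pe(2)] path_edges_verts[OF pe(3)] by auto
  then obtain u where u: "u \<in> verts G" "u \<notin> {x, y} \<union> set P \<union> set Q \<union> set R" using neq by auto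
  note iv = interior_vertex(2)[OF th hd_in_set[OF ne(1)]]
    interior_vertex(2)[OF theta_perm(1)[OF th] hd_in_set[OF ne(2)]]
    interior_vertex(2)[OF theta_perm(1)[OF theta_perm(2)[OF th]] hd_in_set[OF ne(3)]]
  have "p u \<notin> curve (x # P @ [y]) \<union> curve (x # Q @ [y]) \<union> curve (x # R @ [y])"
    using u vertex_in_curve_iff[OF pe(1)] vertex_in_curve_iff[OF pe(2)] vertex_in_curve_iff[OF pe(3)] by auto
  note faces = theta_drawing_faces[OF th _ _ _ iv this]
  have hds: "hd P \<in> set P" "hd Q \<in> set Q" "hd R \<in> set R" using ne by auto
  have "connected_component (- (curve (x # P @ [y]) \<union> curve (x # Q @ [y]))) (p u) (p (hd R))"
    "connected_component (- (curve (x # P @ [y]) \<union> curve (x # R @ [y]))) (p u) (p (hd Q))"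
    "connected_component (- (curve (x # Q @ [y]) \<union> curve (x # R @ [y]))) (p u) (p (hd P))"
    by (rule same_side; use d ne pe u sub hds in \<open>auto simp: disjoint_iff\<close>)+
  then show False using faces ne by blast
qed

text \<open>The edge \<open>{x, y}\<close> is a fourth path \<open>?D\<close>, with a point
  \<open>m\<close> inside it. In the theta without \<open>Q\<close>, no cycle through
  \<open>?D\<close> separates the vertices involved, so the cycle of \<open>P\<close> and
  \<open>R\<close> must separate \<open>?b\<close> from \<open>m\<close>. In the theta without
  \<open>R\<close>, likewise, the cycle of \<open>P\<close> and \<open>Q\<close> separates
  \<open>?c\<close> from \<open>m\<close>. But \<open>m\<close> is separated from only one of the
  three paths.\<close>

theorem fat_theta_nonadjacent:
  assumes "fat_theta (edges G) x y P Q R"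
  shows "{x, y} \<notin> edges G"
proof
  assume xy: "{x, y} \<in> edges G"
  have th: "theta (edges G) x y P Q R" and ne: "P \<noteq> []" "Q \<noteq> []" "R \<noteq> []"
    using assms by (auto simp: fat_theta_def)
  have pe: "path_edges (x # P @ [y]) \<subseteq> edges G" "path_edges (x # Q @ [y]) \<subseteq> edges G"
     "path_edges (x # R @ [y]) \<subseteq> edges G" and d: "distinct (x # y # P @ Q @ R)"
    using th by (auto simp: theta_def)
  have thP: "theta (edges G) x y [] P Q" "theta (edges G) x y [] P R" "theta (edges G) x y [] Q R"
    using th xy by (auto simp: theta_def)
  obtain m where m: "m \<in> path_image (\<gamma> {x, y})" "m \<noteq> p x" "m \<noteq> p y"
    using edge_interior[OF xy] d by (metis distinct_length_2_or_more)
  have c0: "curve (x # [] @ [y]) = path_image (\<gamma> {x, y})" by (simp add: curve_def)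
  have mcur: "m \<in> curve (x # [] @ [y]) - {p x, p y}" using m c0 by auto
  have nm: "m \<notin> curve (x # A @ [y])" if "A \<in> {P, Q, R}" for A
  proof -
    have "curve (x # [] @ [y]) \<inter> curve (x # A @ [y]) = {p x, p y}"
      using that th xy ne by (intro theta_curve_Int) (auto simp: theta_def)
    then show ?thesis using mcur by blast
  qed
  let ?a = "hd P" and ?b = "hd Q" and ?c = "hd R"
  let ?A = "curve (x # P @ [y])" and ?B = "curve (x # Q @ [y])" and ?C = "curve (x # R @ [y])"
    and ?D = "curve (x # [] @ [y])"
  have hds: "?a \<in> set P" "?b \<in> set Q" "?c \<in> set R" using ne by auto
  note iva = interior_vertex[OF th hds(1)] interior_vertex[OF theta_perm(1)[OF thP(1)] hds(1)]
  note ivb = interior_vertex[OF theta_perm(1)[OF th] hds(2)] interior_vertex[OF theta_perm(1)[OF thP(3)] hds(2)]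
  note ivc = interior_vertex[OF theta_perm(1)[OF theta_perm(2)[OF th]] hds(3)]
    interior_vertex[OF theta_perm(1)[OF theta_perm(2)[OF thP(2)]] hds(3)]
  let ?same = "\<lambda>S. connected_component (- S)"
  have sym: "?same S s t \<longleftrightarrow> ?same S t s" for S s t by (rule connected_component_sym_eq)
  have m_faces: "\<not> ?same (?A \<union> ?B) m (p ?c) \<and> ?same (?A \<union> ?C) m (p ?b) \<and> ?same (?B \<union> ?C) m (p ?a) \<or>
    \<not> ?same (?A \<union> ?C) m (p ?b) \<and> ?same (?A \<union> ?B) m (p ?c) \<and> ?same (?B \<union> ?C) m (p ?a) \<or>
    \<not> ?same (?B \<union> ?C) m (p ?a) \<and> ?same (?A \<union> ?B) m (p ?c) \<and> ?same (?A \<union> ?C) m (p ?b)"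
    using nm ne iva ivb ivc by (intro theta_drawing_faces[OF th]) auto
  have ss: "?same (?D \<union> ?A) (p ?b) (p ?c)" "?same (?D \<union> ?B) (p ?a) (p ?c)" "?same (?D \<union> ?C) (p ?a) (p ?b)"
    by (rule same_side; use ne pe d hds xy iva(1) ivb(1) ivc(1) in \<open>auto simp: disjoint_iff\<close>)+
  have "\<not> ?same (?A \<union> ?C) (p ?b) m"
    using theta_drawing_faces[OF thP(2) _ _ _ mcur, of "p ?a" "p ?c" "p ?b"] ne iva ivb ivc ss sym
    by blast
  moreover have "\<not> ?same (?A \<union> ?B) (p ?c) m"
    using theta_drawing_faces[OF thP(1) _ _ _ mcur, of "p ?a" "p ?b" "p ?c"] ne iva ivb ivc ss sym
    by blast
  ultimately show False using m_faces sym by blast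
qed

text \<open>Consider the 4-cycle through \<open>a\<close>, \<open>c\<close>, \<open>b\<close>,
  \<open>d\<close>, with \<open>m\<close> inside the diagonal \<open>{a, b}\<close>,
  \<open>n\<close> inside the diagonal \<open>{c, d}\<close>, and a further vertex \<open>u\<close>.
  The theta made of the cycle and one diagonal shows that the cycle separates \<open>p u\<close>
  from the point on that diagonal, and likewise \<open>n\<close> from \<open>m\<close>. Three
  pairwise separated points contradict the two sides of the cycle.\<close>

theorem K4_spanning:
  assumes d: "distinct [a, b, c, d]"
    and E: "{a, b} \<in> edges G" "{a, c} \<in> edges G" "{a, d} \<in> edges G"
      "{b, c} \<in> edges G" "{b, d} \<in> edges G" "{c, d} \<in> edges G"
  shows "verts G = {a, b, c, d}"
proof (rule ccontr)
  assume neq: "verts G \<noteq> {a, b, c, d}"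
  have sub: "{a, b, c, d} \<subseteq> verts G" using E edge_verts by blast
  then obtain u where u: "u \<in> verts G" "u \<notin> {a, b, c, d}" using neq by auto
  let ?same = "\<lambda>S. connected_component (- S)"
  have th: "theta (edges G) a b [c] [d] []" "theta (edges G) c d [a] [b] []"
    using assms by (auto simp: theta_def insert_commute)
  obtain m where m: "m \<in> path_image (\<gamma> {a, b})" "m \<noteq> p a" "m \<noteq> p b"
    using edge_interior[OF E(1)] d by (metis distinct_length_2_or_more)
  obtain n where n: "n \<in> path_image (\<gamma> {c, d})" "n \<noteq> p c" "n \<noteq> p d"
     "\<And>T. T \<inter> path_image (\<gamma> {c, d}) \<subseteq> {p c} \<Longrightarrow> ?same T n (p d)"
     "\<And>T. T \<inter> path_image (\<gamma> {c, d}) \<subseteq> {p d} \<Longrightarrow> ?same T n (p c)"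
    using edge_interior[OF E(6)] d by (metis distinct_length_2_or_more)
  let ?ab = "curve (a # [] @ [b])" and ?cd = "curve (c # [] @ [d])"
  let ?acb = "curve (a # [c] @ [b])" and ?adb = "curve (a # [d] @ [b])"
    and ?cad = "curve (c # [a] @ [d])" and ?cbd = "curve (c # [b] @ [d])"
  \<comment> \<open>The thetas with branch vertices \<open>a\<close>, \<open>b\<close> and with
    branch vertices \<open>c\<close>, \<open>d\<close> share this 4-cycle, so their separations
    refer to the same curve.\<close>
  have S: "?cad \<union> ?cbd = ?acb \<union> ?adb" by (auto simp: curve_def insert_commute)
  have E': "{c, b} \<in> edges G" "{d, b} \<in> edges G" "{c, a} \<in> edges G"
    using E by (auto simp: insert_commute)
  have E_Int: "path_image (\<gamma> e) \<inter> path_image (\<gamma> {c, d}) \<subseteq> p ` (e \<inter> {c, d})"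
    if "e \<in> {{a, b}, {a, c}, {a, d}, {c, b}, {d, b}}" for e
    using that d E E' by (intro edge_image_Int) (auto simp: doubleton_eq_iff)
  have acb_cd: "(?acb \<union> ?ab) \<inter> path_image (\<gamma> {c, d}) \<subseteq> {p c}"
    using E_Int[of "{a, b}"] E_Int[of "{a, c}"] E_Int[of "{c, b}"] d by (auto simp: curve_def)
  have adb_cd: "(?adb \<union> ?ab) \<inter> path_image (\<gamma> {c, d}) \<subseteq> {p d}"
    using E_Int[of "{a, b}"] E_Int[of "{a, d}"] E_Int[of "{d, b}"] d by (auto simp: curve_def)
  have n_off: "n \<notin> ?acb \<union> ?adb \<union> ?ab" using acb_cd adb_cd n by blast
  have u_off: "p u \<notin> ?acb \<union> ?adb \<union> ?ab" "p u \<notin> ?cad \<union> ?cbd \<union> ?cd"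
    using u E E' by (auto simp: vertex_in_curve_iff insert_commute)
  note iv = interior_vertex(2)[OF th(1) list.set_intros(1)] interior_vertex(2)[OF theta_perm(1)[OF th(1)] list.set_intros(1)]
    interior_vertex(2)[OF th(2) list.set_intros(1)] interior_vertex(2)[OF theta_perm(1)[OF th(2)] list.set_intros(1)]
  have m_on: "m \<in> ?ab - {p a, p b}" and n_on: "n \<in> ?cd - {p c, p d}"
    using m n by (auto simp: curve_def)
  have "?same (?acb \<union> ?ab) (p u) (p d)" "?same (?adb \<union> ?ab) (p u) (p c)"
    "?same (?cad \<union> ?cd) (p u) (p b)" "?same (?cbd \<union> ?cd) (p u) (p a)"
    using u d E E' sub by (intro same_side; force simp: insert_commute)+
  \<comment> \<open>For \<open>n\<close>, which is no vertex, the edge \<open>{c, d}\<close> itself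
    provides the connection that \<open>same_side\<close> provides for \<open>u\<close>.\<close>
  moreover have "?same (?acb \<union> ?ab) n (p d)" "?same (?adb \<union> ?ab) n (p c)"
    using n(4)[OF acb_cd] n(5)[OF adb_cd] by auto
  moreover note ne = disjI1[OF list.distinct(2)]
  note faces_u = theta_drawing_faces[OF th(1) ne ne ne iv(1,2) m_on u_off(1)]
    and faces_n = theta_drawing_faces[OF th(1) ne ne ne iv(1,2) m_on n_off]
    and faces_u' = theta_drawing_faces[OF th(2) ne ne ne iv(3,4) n_on u_off(2)]
  ultimately have um: "\<not> ?same (?acb \<union> ?adb) (p u) m" and nm: "\<not> ?same (?acb \<union> ?adb) n m"
    and un: "\<not> ?same (?cad \<union> ?cbd) (p u) n"
    using faces_u faces_n faces_u' by blast+
  have m_off: "m \<notin> ?acb \<union> ?adb"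
    using theta_curve_Int[of a b "[]" "[c]"] theta_curve_Int[of a b "[]" "[d]"] m_on th(1)
    unfolding theta_def by auto
  have acb: "distinct (a # [c] @ [b])" "path_edges (a # [c] @ [b]) \<subseteq> edges G"
    and adb: "distinct (a # [d] @ [b])" "path_edges (a # [d] @ [b]) \<subseteq> edges G"
    using th(1) d by (auto simp: theta_def)
  obtain g1 where g1: "arc g1" "pathstart g1 = p a" "pathfinish g1 = p b" "path_image g1 = ?acb"
    using theta_arcs[OF acb] .
  obtain g2 where g2: "arc g2" "pathstart g2 = p a" "pathfinish g2 = p b" "path_image g2 = ?adb"
    using theta_arcs[OF adb] .
  have "?acb \<inter> ?adb = {p a, p b}"
    by (rule theta_curve_Int; use acb adb d in auto)
  then have "?same (?acb \<union> ?adb) (p u) n \<or> ?same (?acb \<union> ?adb) (p u) m \<or> ?same (?acb \<union> ?adb) n m"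
    using Jordan_arcs_two_sides[OF g1(1) g2(1) g1(2,3) g2(2,3), unfolded g1(4) g2(4)]
      u_off(1) n_off m_off by blast
  then show False using um nm un unfolding S by blast
qed

end

subsection \<open>Outerplanar drawings from noncrossing orders\<close>

lemma cos_less_chord:
  fixes h t :: real
  assumes "0 < h" "h < t" "t < 2 * pi - h"
  shows "cos t < cos h"
proof (cases "t \<le> pi")
  case True
  then show ?thesis using assms by (intro cos_monotone_0_pi) auto
next
  case False
  have "cos (2 * pi - t) < cos h" using assms False by (intro cos_monotone_0_pi) auto
  then show ?thesis by simp
qed

text \<open>A linear functional that vanishes on the chord between the angles \<open>\<alpha>\<close> and \<open>\<beta>\<close>; its sign
  tells the two arcs of the circle cut off by the chord apart.\<close>

definition chord_side :: "real \<Rightarrow> real \<Rightarrow> complex \<Rightarrow> real" where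
  "chord_side \<alpha> \<beta> z = Re (z * cis (- ((\<alpha> + \<beta>) / 2))) - cos ((\<beta> - \<alpha>) / 2)"

lemma chord_side_cis: "chord_side \<alpha> \<beta> (cis t) = cos (t - (\<alpha> + \<beta>) / 2) - cos ((\<beta> - \<alpha>) / 2)"
  by (simp add: chord_side_def cis_mult del: cis.sel) (simp add: cis.sel)

lemma chord_side_ends: "chord_side \<alpha> \<beta> (cis \<alpha>) = 0" "chord_side \<alpha> \<beta> (cis \<beta>) = 0"
proof -
  have "\<alpha> - (\<alpha> + \<beta>) / 2 = - ((\<beta> - \<alpha>) / 2)" "\<beta> - (\<alpha> + \<beta>) / 2 = (\<beta> - \<alpha>) / 2"
    by (simp_all add: field_simps)
  then show "chord_side \<alpha> \<beta> (cis \<alpha>) = 0" "chord_side \<alpha> \<beta> (cis \<beta>) = 0"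
    unfolding chord_side_cis by (simp_all only: cos_minus diff_self)
qed

lemma chord_side_pos:
  assumes "\<alpha> < t" "t < \<beta>" "\<beta> - \<alpha> < 2 * pi"
  shows "chord_side \<alpha> \<beta> (cis t) > 0"
proof -
  have "cos ((\<beta> - \<alpha>) / 2) < cos \<bar>t - (\<alpha> + \<beta>) / 2\<bar>"
    using assms by (intro cos_monotone_0_pi) (auto simp: field_simps abs_if)
  then show ?thesis by (simp add: chord_side_cis)
qed

lemma chord_side_neg:
  assumes "0 \<le> \<alpha>" "\<alpha> < \<beta>" "\<beta> < 2 * pi" "0 \<le> t" "t < 2 * pi" "t < \<alpha> \<or> \<beta> < t"
  shows "chord_side \<alpha> \<beta> (cis t) < 0"
proof -
  have "cos \<bar>t - (\<alpha> + \<beta>) / 2\<bar> < cos ((\<beta> - \<alpha>) / 2)"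
    using assms by (intro cos_less_chord) (auto simp: field_simps abs_if)
  then show ?thesis by (simp add: chord_side_cis)
qed

lemma chord_side_segment:
  "chord_side \<alpha> \<beta> ((1 - u) *\<^sub>R z + u *\<^sub>R w) = (1 - u) * chord_side \<alpha> \<beta> z + u * chord_side \<alpha> \<beta> w"
  by (simp add: chord_side_def algebra_simps)

text \<open>The vertices become the corners of a regular polygon in the order of \<open>vs\<close>.
  For an edge \<open>e\<close>, the affine function \<open>f e\<close> vanishes on its chord, is
  positive at the vertices strictly between its ends and negative at those beyond them. Noncrossing
  means that \<open>f e\<close> never has strictly opposite signs at the ends of another edge, so
  the other chord can reach the zero line only at a common end.\<close>

lemma outerplanar_of_noncrossing:
  assumes simple: "finite_simple_graph G"
    and vs: "distinct vs" "set vs = verts G" "noncrossing (edges G) vs"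
  shows "outerplanar G"
proof -
  define n where "n = length vs"
  define idx where "idx v = (THE i. i < n \<and> vs ! i = v)" for v
  have idx_nth: "idx (vs ! i) = i" if "i < n" for i
    unfolding idx_def using that vs(1) by (auto simp: n_def nth_eq_iff_index_eq)
  have idx: "idx v < n" "vs ! idx v = v" if "v \<in> verts G" for v
  proof -
    obtain i where "i < n" "vs ! i = v" using \<open>v \<in> verts G\<close> vs(2) by (metis in_set_conv_nth n_def)
    then show "idx v < n" "vs ! idx v = v" using idx_nth by auto
  qed
  define ang where "ang i = 2 * pi * real i / real n" for i
  have ang0: "0 \<le> ang i" for i by (simp add: ang_def)
  have ang_less: "ang i < ang j" if "i < j" "j < n" for i j
    using that by (simp add: ang_def divide_strict_right_mono)
  have ang2pi: "ang i < 2 * pi" if "i < n" for i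
    using that by (simp add: ang_def field_simps)
  define p where "p v = cis (ang (idx v))" for v
  have ends: "\<exists>u v. e = {u, v} \<and> u \<in> verts G \<and> v \<in> verts G \<and> idx u < idx v" if "e \<in> edges G" for e
  proof -
    have "e \<subseteq> verts G" "card e = 2" using that simple by (auto simp: finite_simple_graph_def)
    then obtain u v where "e = {u, v}" "u \<noteq> v" "u \<in> verts G" "v \<in> verts G"
      by (auto simp: card_2_iff)
    then show ?thesis using idx by (metis insert_commute nat_neq_iff)
  qed
  \<comment> \<open>The two ends of an edge have different indices, so both choices are unique and
    orient the edge by position.\<close>
  define lo where "lo e = (SOME u. u \<in> e \<and> (\<forall>v\<in>e. idx u \<le> idx v))" for e
  define hi where "hi e = (SOME u. u \<in> e \<and> (\<forall>v\<in>e. idx v \<le> idx u))" for e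
  have lohi: "e = {lo e, hi e}" "lo e \<in> verts G" "hi e \<in> verts G" "idx (lo e) < idx (hi e)"
    if "e \<in> edges G" for e
  proof -
    obtain u v where uv: "e = {u, v}" "u \<in> verts G" "v \<in> verts G" "idx u < idx v"
      using ends \<open>e \<in> edges G\<close> by blast
    have "lo e = u" "hi e = v"
      unfolding lo_def hi_def using uv by (auto intro!: some_equality)
    then show "e = {lo e, hi e}" "lo e \<in> verts G" "hi e \<in> verts G" "idx (lo e) < idx (hi e)"
      using uv by auto
  qed
  define \<gamma> where "\<gamma> e = linepath (p (lo e)) (p (hi e))" for e
  define f where "f e = chord_side (ang (idx (lo e))) (ang (idx (hi e)))" for e
  have f_ends: "f e (p v) = 0" if "e \<in> edges G" "v \<in> e" for e v
    using lohi[OF that(1)] that(2) chord_side_ends unfolding f_def p_def by force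
  have f_pos: "f e (p v) > 0" if "e \<in> edges G" "v \<in> verts G" "idx (lo e) < idx v" "idx v < idx (hi e)" for e v
    using that ang_less idx lohi(3)[OF that(1)] ang2pi[of "idx (hi e)"] ang0[of "idx (lo e)"]
    unfolding f_def p_def by (intro chord_side_pos) auto
  have f_neg: "f e (p v) < 0" if "e \<in> edges G" "v \<in> verts G" "idx v < idx (lo e) \<or> idx (hi e) < idx v" for e v
    using that ang_less idx lohi[OF that(1)] ang2pi ang0
    unfolding f_def p_def by (intro chord_side_neg) auto
  have f_zero: "v \<in> e" if "e \<in> edges G" "v \<in> verts G" "f e (p v) = 0" for e v
  proof -
    have "idx v = idx (lo e) \<or> idx v = idx (hi e)"
      using f_pos[OF that(1,2)] f_neg[OF that(1,2)] that(3) by (metis less_irrefl linorder_neqE_nat)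
    then have "v = lo e \<or> v = hi e" using idx(2) lohi(2,3)[OF that(1)] that(2) by metis
    then show ?thesis using lohi(1)[OF that(1)] by blast
  qed
  have f_posD: "idx (lo e) < idx v \<and> idx v < idx (hi e)" if "f e (p v) > 0" "e \<in> edges G" "v \<in> verts G" for e v
  proof -
    have "v \<notin> e" "\<not> (idx v < idx (lo e) \<or> idx (hi e) < idx v)"
      using f_ends[OF that(2)] f_neg[OF that(2,3)] that(1) by force+
    then have "v \<noteq> lo e" "v \<noteq> hi e" using lohi(1)[OF that(2)] by blast+
    then have "idx v \<noteq> idx (lo e)" "idx v \<noteq> idx (hi e)"
      using idx(2) lohi(2,3)[OF that(2)] that(3) by metis+
    then show ?thesis using \<open>\<not> (idx v < idx (lo e) \<or> idx (hi e) < idx v)\<close> by auto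
  qed
  have f_negD: "idx v < idx (lo e) \<or> idx (hi e) < idx v" if "f e (p v) < 0" "e \<in> edges G" "v \<in> verts G" for e v
  proof -
    have "v \<notin> e" "\<not> (idx (lo e) < idx v \<and> idx v < idx (hi e))"
      using f_ends[OF that(2)] f_pos[OF that(2,3)] that(1) by force+
    then have "v \<noteq> lo e" "v \<noteq> hi e" using lohi(1)[OF that(2)] by blast+
    then have "idx v \<noteq> idx (lo e)" "idx v \<noteq> idx (hi e)"
      using idx(2) lohi(2,3)[OF that(2)] that(3) by metis+
    then show ?thesis using \<open>\<not> (idx (lo e) < idx v \<and> idx v < idx (hi e))\<close> by auto
  qed
  have f_chord: "f e z = 0" if "e \<in> edges G" "z \<in> path_image (\<gamma> e)" for e z
  proof -
    note z = that(2)
    obtain u where "z = (1 - u) *\<^sub>R p (lo e) + u *\<^sub>R p (hi e)"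
      using z by (auto simp: \<gamma>_def path_image_linepath in_segment)
    moreover have "f e (p (lo e)) = 0" "f e (p (hi e)) = 0" using f_ends lohi(1) that(1) by blast+
    ultimately show ?thesis by (simp add: f_def chord_side_segment)
  qed
  have inj: "inj_on p (verts G)"
  proof (rule inj_onI, rule ccontr)
    fix u v assume uv: "u \<in> verts G" "v \<in> verts G" "p u = p v" "u \<noteq> v"
    have "p a \<noteq> p b" if "a \<in> verts G" "b \<in> verts G" "idx a < idx b" for a b
    proof
      assume eq: "p a = p b"
      \<comment> \<open>The angles differ by a number strictly between 0 and 2 pi. The sine of half
        of it is positive, so its cosine, 1 minus twice the square of that sine, is not 1.\<close>
      have "cis (ang (idx b) - ang (idx a)) = 1"
        using eq by (simp add: p_def flip: cis_divide)
      then have "cos (ang (idx b) - ang (idx a)) = 1" by (metis cis.sel(1) one_complex.sel(1))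
      moreover have "ang (idx a) < ang (idx b)" "ang (idx b) < 2 * pi" "0 \<le> ang (idx a)"
        using ang_less[OF that(3)] that idx ang2pi ang0 by auto
      then have "sin ((ang (idx b) - ang (idx a)) / 2) > 0" by (intro sin_gt_zero) auto
      ultimately show False
        using cos_double_sin[of "(ang (idx b) - ang (idx a)) / 2"] by (simp only: mult_2 field_sum_of_halves) simp
    qed
    then show False using uv idx by (metis nat_neq_iff)
  qed
  have meet: "path_image (\<gamma> e) \<inter> path_image (\<gamma> e') \<subseteq> p ` (e \<inter> e')"
    if e: "e \<in> edges G" "e' \<in> edges G" "e \<noteq> e'" for e e'
  proof
    fix z assume z: "z \<in> path_image (\<gamma> e) \<inter> path_image (\<gamma> e')"
    let ?u = "lo e'" and ?v = "hi e'"
    note L = lohi[OF e(1)] and L' = lohi[OF e(2)]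
    obtain t where t: "0 \<le> t" "t \<le> 1" "z = (1 - t) *\<^sub>R p ?u + t *\<^sub>R p ?v"
      using z by (auto simp: \<gamma>_def path_image_linepath in_segment)
    have "f e z = 0" using f_chord e z by blast
    then have eq: "(1 - t) * f e (p ?u) + t * f e (p ?v) = 0"
      using t by (simp add: f_def chord_side_segment)
    have nc: False if "a < b" "b < c" "c < d" "d < n" "{vs ! a, vs ! c} \<in> edges G" "{vs ! b, vs ! d} \<in> edges G" for a b c d
      using vs(3) that unfolding noncrossing_def n_def by blast
    have vs_e: "{vs ! idx (lo e), vs ! idx (hi e)} \<in> edges G" "{vs ! idx ?u, vs ! idx ?v} \<in> edges G"
      using idx(2) L L' e by simp_all
    have "\<not> (f e (p ?u) > 0 \<and> f e (p ?v) < 0)"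
    proof
      assume "f e (p ?u) > 0 \<and> f e (p ?v) < 0"
      then have "idx (lo e) < idx ?u" "idx ?u < idx (hi e)" "idx (hi e) < idx ?v"
        using f_posD[OF _ e(1) L'(2)] f_negD[OF _ e(1) L'(3)] L'(4) by auto
      then show False using nc[OF _ _ _ _ vs_e] idx(1)[OF L'(3)] by blast
    qed
    moreover have "\<not> (f e (p ?u) < 0 \<and> f e (p ?v) > 0)"
    proof
      assume "f e (p ?u) < 0 \<and> f e (p ?v) > 0"
      then have "idx ?u < idx (lo e)" "idx (lo e) < idx ?v" "idx ?v < idx (hi e)"
        using f_posD[OF _ e(1) L'(3)] f_negD[OF _ e(1) L'(2)] L'(4) by auto
      then show False using nc[OF _ _ _ _ vs_e(2,1)] idx(1)[OF L(3)] by blast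
    qed
    moreover have "\<not> (f e (p ?u) = 0 \<and> f e (p ?v) = 0)"
    proof
      assume "f e (p ?u) = 0 \<and> f e (p ?v) = 0"
      then have "?u \<in> e" "?v \<in> e" using f_zero e(1) L' by auto
      moreover have "?u \<noteq> ?v" "lo e \<noteq> hi e" using L(4) L'(4) by auto
      moreover have "w = lo e \<or> w = hi e" if "w \<in> e" for w using that L(1) by blast
      ultimately have "{?u, ?v} = {lo e, hi e}" by (metis insert_commute)
      then have "e = e'" using L(1) L'(1) by simp
      then show False using e by simp
    qed
    \<comment> \<open>With a single zero, \<open>eq\<close> forces \<open>z\<close> to be that end.
      With equal strict signs, a convex combination cannot vanish.\<close>
    ultimately consider "f e (p ?u) = 0" "f e (p ?v) \<noteq> 0" | "f e (p ?u) \<noteq> 0" "f e (p ?v) = 0"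
      | "f e (p ?u) > 0" "f e (p ?v) > 0" | "f e (p ?u) < 0" "f e (p ?v) < 0"
      by linarith
    then show "z \<in> p ` (e \<inter> e')"
    proof cases
      case 1
      then have "z = p ?u" "?u \<in> e" using eq t f_zero e(1) L' by auto
      then show ?thesis using L' by blast
    next
      case 2
      then have "z = p ?v" "?v \<in> e" using eq t f_zero e(1) L' by auto
      then show ?thesis using L' by blast
    next
      case 3
      then have "(1 - t) * f e (p ?u) \<ge> 0" "t * f e (p ?v) \<ge> 0" using t by auto
      then have "(1 - t) * f e (p ?u) = 0" "t * f e (p ?v) = 0" using eq by linarith+
      then show ?thesis using 3 by auto
    next
      case 4
      then have "(1 - t) * f e (p ?u) \<le> 0" "t * f e (p ?v) \<le> 0" using t by (auto simp: mult_nonneg_nonpos)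
      then have "(1 - t) * f e (p ?u) = 0" "t * f e (p ?v) = 0" using eq by linarith+
      then show ?thesis using 4 by auto
    qed
  qed
  have "planar_drawing G p \<gamma>"
    unfolding planar_drawing_def
  proof (intro conjI ballI impI)
    show "inj_on p (verts G)" by (rule inj)
    fix e assume e: "e \<in> edges G"
    note L = lohi[OF e]
    have "lo e \<noteq> hi e" using L(4) by auto
    then have "p (lo e) \<noteq> p (hi e)" using inj L(2,3) by (auto dest: inj_onD)
    then show "arc (\<gamma> e)" by (simp add: \<gamma>_def)
    have "p ` e = {p (lo e), p (hi e)}" using arg_cong[OF L(1), of "image p"] by simp
    then show ends: "{pathstart (\<gamma> e), pathfinish (\<gamma> e)} = p ` e" by (simp add: \<gamma>_def)
    show "path_image (\<gamma> e) \<inter> p ` verts G = p ` e"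
    proof
      show "path_image (\<gamma> e) \<inter> p ` verts G \<subseteq> p ` e" using f_chord[OF e] f_zero[OF e] by blast
      have "p ` e \<subseteq> path_image (\<gamma> e)" unfolding ends[symmetric] by auto
      moreover have "e \<subseteq> verts G" using e simple by (auto simp: finite_simple_graph_def)
      ultimately show "p ` e \<subseteq> path_image (\<gamma> e) \<inter> p ` verts G" by auto
    qed
  next
    fix e e' assume "e \<in> edges G" "e' \<in> edges G" "e \<noteq> e'"
    then show "path_image (\<gamma> e) \<inter> path_image (\<gamma> e') \<subseteq> p ` (e \<inter> e')" by (rule meet)
  qed
  moreover have "p ` verts G \<subseteq> sphere 0 1" by (auto simp: p_def)
  moreover have "path_image (\<gamma> e) \<subseteq> cball 0 1" for e
    unfolding \<gamma>_def path_image_linepath by (intro closed_segment_subset) (auto simp: p_def)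
  ultimately show ?thesis
    unfolding outerplanar_def by (intro exI[of _ p] exI[of _ \<gamma>] exI[of _ 0] exI[of _ 1]) auto
qed

subsection \<open>Noncrossing orders of graphs without fat thetas\<close>

lemma noncrossing_rotate1:
  assumes "noncrossing E (v # vs)"
  shows "noncrossing E (vs @ [v])"
  unfolding noncrossing_def
proof (intro allI impI)
  fix a b c d
  assume *: "a < b" "b < c" "c < d" "d < length (vs @ [v])"
    "{(vs @ [v]) ! a, (vs @ [v]) ! c} \<in> E"
  have nc: "{(v # vs) ! i, (v # vs) ! k} \<in> E \<Longrightarrow> {(v # vs) ! j, (v # vs) ! l} \<notin> E"
    if "i < j" "j < k" "k < l" "l < Suc (length vs)" for i j k l
    using that assms unfolding noncrossing_def by simp
  show "{(vs @ [v]) ! b, (vs @ [v]) ! d} \<notin> E"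
  proof (cases "d = length vs")
    case False
    then show ?thesis
      using * nc[of "Suc a" "Suc b" "Suc c" "Suc d"] by (simp add: nth_append)
  next
    \<comment> \<open>The last position holds \<open>v\<close>, formerly first. After moving it back
      to the front the two chords exchange their roles.\<close>
    case True
    then show ?thesis
      using * nc[of 0 "Suc a" "Suc b" "Suc c"] by (auto simp: nth_append insert_commute)
  qed
qed

lemma noncrossing_rotate: "noncrossing E (xs @ ys) \<Longrightarrow> noncrossing E (ys @ xs)"
proof (induction xs arbitrary: ys)
  case (Cons a xs)
  then have "noncrossing E (xs @ ys @ [a])" using noncrossing_rotate1[of E a "xs @ ys"] by simp
  then show ?case using Cons.IH[of "ys @ [a]"] by simp
qed simp

text \<open>If an edge of \<open>E1\<close> crossed one of \<open>E2\<close>, two ends at different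
  positions would both lie in the overlap \<open>S\<close>, which has at most one position.\<close>

lemma noncrossing_append:
  assumes "noncrossing E1 (A @ S)" "noncrossing E2 (S @ B)"
    and d: "distinct (A @ S @ B)" and S: "length S \<le> 1"
    and E1: "\<And>e. e \<in> E1 \<Longrightarrow> e \<subseteq> set (A @ S)" and E2: "\<And>e. e \<in> E2 \<Longrightarrow> e \<subseteq> set (S @ B)"
  shows "noncrossing (E1 \<union> E2) (A @ S @ B)"
  unfolding noncrossing_def
proof (intro allI impI notI)
  let ?vs = "A @ S @ B"
  fix a b c d
  assume *: "a < b" "b < c" "c < d" "d < length ?vs"
    "{?vs ! a, ?vs ! c} \<in> E1 \<union> E2" "{?vs ! b, ?vs ! d} \<in> E1 \<union> E2"
  have left: "i < length A + length S" if "i < length ?vs" "?vs ! i \<in> set (A @ S)" for i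
  proof (rule ccontr)
    assume "\<not> i < length A + length S"
    then have "?vs ! i \<in> set B" using that(1) by (auto simp: nth_append)
    then show False using that(2) d by auto
  qed
  have right: "length A \<le> i" if "i < length ?vs" "?vs ! i \<in> set (S @ B)" for i
  proof (rule ccontr)
    assume "\<not> length A \<le> i"
    then have "?vs ! i \<in> set A" by (auto simp: nth_append)
    then show False using that(2) d by auto
  qed
  from *(5,6) consider "{?vs ! a, ?vs ! c} \<in> E1" "{?vs ! b, ?vs ! d} \<in> E1"
    | "{?vs ! a, ?vs ! c} \<in> E1" "{?vs ! b, ?vs ! d} \<in> E2"
    | "{?vs ! a, ?vs ! c} \<in> E2" "{?vs ! b, ?vs ! d} \<in> E1"
    | "{?vs ! a, ?vs ! c} \<in> E2" "{?vs ! b, ?vs ! d} \<in> E2"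
    by blast
  then show False
  proof cases
    case 1
    have nth: "?vs ! i = (A @ S) ! i" if "i \<le> d" for i
      using that left[of d] E1[OF 1(2)] *(4) by (auto simp: nth_append)
    have "d < length (A @ S)" using left[of d] E1[OF 1(2)] *(4) by auto
    then show False using assms(1) * 1 nth unfolding noncrossing_def by fastforce
  next
    case 2
    then show False using left[of c] right[of b] E1[OF 2(1)] E2[OF 2(2)] * S by auto
  next
    case 3
    then show False using left[of d] right[of a] E2[OF 3(1)] E1[OF 3(2)] * S by auto
  next
    case 4
    have a: "length A \<le> a" using right[of a] E2[OF 4(1)] * by auto
    have nth: "?vs ! i = (S @ B) ! (i - length A)" if "a \<le> i" for i
      using that a by (auto simp: nth_append)
    have "{(S @ B) ! (a - length A), (S @ B) ! (c - length A)} \<in> E2"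
      "{(S @ B) ! (b - length A), (S @ B) ! (d - length A)} \<in> E2"
      using 4 nth * by auto
    moreover have "a - length A < b - length A" "b - length A < c - length A"
      "c - length A < d - length A" "d - length A < length (S @ B)" using a * by auto
    ultimately show False using assms(2) unfolding noncrossing_def by blast
  qed
qed

text \<open>Both orders are rotated so that the common vertex, if any, ends the first and starts the
  second; then they overlap as \<open>noncrossing_append\<close> requires.\<close>

lemma noncrossing_separation:
  assumes vs1: "distinct vs1" "noncrossing E1 vs1" "\<And>e. e \<in> E1 \<Longrightarrow> e \<subseteq> set vs1"
    and vs2: "distinct vs2" "noncrossing E2 vs2" "\<And>e. e \<in> E2 \<Longrightarrow> e \<subseteq> set vs2"
    and card: "card (set vs1 \<inter> set vs2) \<le> 1"
  shows "\<exists>vs. distinct vs \<and> set vs = set vs1 \<union> set vs2 \<and> noncrossing (E1 \<union> E2) vs"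
proof (cases "set vs1 \<inter> set vs2 = {}")
  case True
  then show ?thesis
    using noncrossing_append[of E1 vs1 "[]" E2 vs2] assms by (intro exI[of _ "vs1 @ vs2"]) auto
next
  case False
  then have "card (set vs1 \<inter> set vs2) = 1" using card by (simp add: le_Suc_eq)
  then obtain s where s: "set vs1 \<inter> set vs2 = {s}" by (rule card_1_singletonE)
  then have "s \<in> set vs1" "s \<in> set vs2" by auto
  then obtain A1 A2 B1 B2 where split: "vs1 = A1 @ s # A2" "vs2 = B1 @ s # B2" by (meson split_list)
  define A where "A = A2 @ A1"
  define B where "B = B2 @ B1"
  have sets: "set (A @ [s]) = set vs1" "set ([s] @ B) = set vs2" by (auto simp: split A_def B_def)
  have "noncrossing E1 (A @ [s])"
    using noncrossing_rotate[of E1 "A1 @ [s]" A2] vs1(2)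
    by (simp add: split A_def)
  moreover have "noncrossing E2 ([s] @ B)"
    using noncrossing_rotate[of E2 B1 "s # B2"] vs2(2) by (simp add: split B_def)
  moreover have "distinct (A @ [s] @ B)"
    using vs1(1) vs2(1) s unfolding split A_def B_def by auto
  ultimately have "noncrossing (E1 \<union> E2) (A @ [s] @ B)"
    using vs1(3) vs2(3) by (intro noncrossing_append) (auto simp flip: sets)
  then show ?thesis
    using \<open>distinct (A @ [s] @ B)\<close> sets by (intro exI[of _ "A @ [s] @ B"]) auto
qed

text \<open>K4 is excluded as a subgraph, not as a subdivision: a cycle with two crossing chords and
  a vertex inside one of its four arcs already yields a fat theta, by
  \<open>crossed_square_fat_theta\<close>.\<close>

definition K4_free :: "'v set set \<Rightarrow> bool" where
  "K4_free E \<longleftrightarrow> (\<forall>a b c d. distinct [a, b, c, d] \<longrightarrow>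
     \<not> ({a, b} \<in> E \<and> {a, c} \<in> E \<and> {a, d} \<in> E \<and> {b, c} \<in> E \<and> {b, d} \<in> E \<and> {c, d} \<in> E))"

definition fat_theta_free :: "'v set set \<Rightarrow> bool" where
  "fat_theta_free E \<longleftrightarrow> (\<forall>x y P Q R. \<not> fat_theta E x y P Q R)"

text \<open>Besides the arc \<open>P\<close> there are two more routes from \<open>a\<close> to
  \<open>b\<close>: the chord to \<open>c\<close> and back along \<open>Q\<close>, or back along
  \<open>S\<close> to \<open>d\<close> and then the other chord. They have the interior vertices
  \<open>c\<close> and \<open>d\<close>.\<close>

lemma crossed_square_fat_theta:
  assumes "distinct (a # b # c # d # P @ Q @ R @ S)" "P \<noteq> []"
    and "path_edges (a # P @ [b]) \<subseteq> E" "path_edges (b # Q @ [c]) \<subseteq> E"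
      "path_edges (c # R @ [d]) \<subseteq> E" "path_edges (d # S @ [a]) \<subseteq> E"
    and "{a, c} \<in> E" "{b, d} \<in> E"
  shows "fat_theta E a b P (c # rev Q) (rev S @ [d])"
proof -
  have "path_edges (c # rev Q @ [b]) \<subseteq> E" "path_edges (a # rev S @ [d]) \<subseteq> E"
    using assms(4,6) path_edges_rev[of "b # Q @ [c]"] path_edges_rev[of "d # S @ [a]"] by auto
  then show ?thesis
    using assms path_edges_append[of "a # rev S @ [d]" "[b]"]
    by (auto simp: fat_theta_def theta_def insert_commute)
qed

text \<open>Two crossing chords cut the cycle into four arcs. By
  \<open>crossed_square_fat_theta\<close>, applied from each of the four corners, no arc has an
  interior vertex, so the corners span a K4.\<close>

lemma noncrossing_hamiltonian:
  assumes d: "distinct cs" and E: "path_edges (cs @ [hd cs]) \<subseteq> E"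
    and free: "fat_theta_free E" "K4_free E"
  shows "noncrossing E cs"
  unfolding noncrossing_def
proof (intro allI impI notI)
  fix i j k l
  assume *: "i < j" "j < k" "k < l" "l < length cs"
    "{cs ! i, cs ! k} \<in> E" "{cs ! j, cs ! l} \<in> E"
  define P0 P Q R S0 where "P0 = take i cs" and "P = take (j - Suc i) (drop (Suc i) cs)"
    and "Q = take (k - Suc j) (drop (Suc j) cs)" and "R = take (l - Suc k) (drop (Suc k) cs)"
    and "S0 = drop (Suc l) cs"
  have step: "drop (Suc m) cs = take (n - Suc m) (drop (Suc m) cs) @ cs ! n # drop (Suc n) cs"
    if "m < n" "n < length cs" for m n
    using id_take_nth_drop[of "n - Suc m" "drop (Suc m) cs"] that by simp
  have cs: "cs = P0 @ cs ! i # P @ cs ! j # Q @ cs ! k # R @ cs ! l # S0"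
    using id_take_nth_drop[of i cs] step[of i j] step[of j k] step[of k l] *
    by (simp add: P0_def P_def Q_def R_def S0_def)
  obtain a b c d where abcd: "a = cs ! i" "b = cs ! j" "c = cs ! k" "d = cs ! l" by blast
  note cs = cs[folded abcd]
  \<comment> \<open>The fourth arc runs over the end of the list: it consists of what follows
    \<open>d\<close> and then what precedes \<open>a\<close>.\<close>
  have dist: "distinct (a # b # c # d # P @ Q @ R @ (S0 @ P0))"
    using d unfolding cs by auto
  have hdcs: "hd cs = (if P0 = [] then a else hd P0)" by (subst cs) simp
  have pe: "path_edges (a # P @ [b]) \<subseteq> E" "path_edges (b # Q @ [c]) \<subseteq> E" "path_edges (c # R @ [d]) \<subseteq> E"
    "path_edges (d # (S0 @ P0) @ [a]) \<subseteq> E"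
    using E[unfolded hdcs, unfolded cs] by (auto simp: path_edges_append path_edges_Cons split: if_splits)
  have ch: "{a, c} \<in> E" "{b, d} \<in> E" using *(5,6) by (simp_all add: abcd)
  have "P = []"
    using crossed_square_fat_theta[OF dist _ pe ch] free(1) by (auto simp: fat_theta_free_def)
  moreover have "distinct (b # c # d # a # Q @ R @ (S0 @ P0) @ P)" "distinct (c # d # a # b # R @ (S0 @ P0) @ P @ Q)"
    "distinct (d # a # b # c # (S0 @ P0) @ P @ Q @ R)"
    using dist by (auto simp: disjoint_iff)
  note dists = this
  have "{c, a} \<in> E" "{d, b} \<in> E" using ch by (simp_all add: insert_commute)
  note ch' = this
  have "Q = []"
    using crossed_square_fat_theta[OF dists(1) _ pe(2,3,4,1) ch(2) ch'(1)] free(1) by (auto simp: fat_theta_free_def)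
  moreover have "R = []"
    using crossed_square_fat_theta[OF dists(2) _ pe(3,4,1,2) ch'] free(1) by (auto simp: fat_theta_free_def)
  moreover have "S0 @ P0 = []"
    using crossed_square_fat_theta[OF dists(3) _ pe(4,1,2,3) ch'(2) ch(1)] free(1)
    unfolding fat_theta_free_def by blast
  ultimately have "{a, b} \<in> E" "{b, c} \<in> E" "{c, d} \<in> E" "{a, d} \<in> E" "distinct [a, b, c, d]"
    using pe dist by (auto simp: insert_commute)
  then show False using ch free(2) unfolding K4_free_def by blast
qed

section \<open>Longest cycles in nonseparable graphs\<close>

lemma rtrancl_path:
  assumes "(u, v) \<in> {(a, b). {a, b} \<in> E \<and> a \<notin> C \<and> b \<notin> C}\<^sup>*" "u \<notin> C"
  shows "\<exists>P. P \<noteq> [] \<and> hd P = u \<and> last P = v \<and> distinct P \<and> path_edges P \<subseteq> E \<and> set P \<inter> C = {}"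
  using assms(1)
proof (induction rule: rtrancl_induct)
  case base
  then show ?case using assms(2) by (intro exI[of _ "[u]"]) auto
next
  case (step v w)
  then obtain P where P: "P \<noteq> []" "hd P = u" "last P = v" "distinct P" "path_edges P \<subseteq> E" "set P \<inter> C = {}"
    by auto
  show ?case
  proof (cases "w \<in> set P")
    case True
    then obtain P1 P2 where "P = P1 @ w # P2" by (meson split_list)
    then show ?thesis using P
      by (intro exI[of _ "P1 @ [w]"]) (auto simp: path_edges_append hd_append split: if_splits)
  next
    case False
    then show ?thesis using P step(2)
      by (intro exI[of _ "P @ [w]"]) (auto simp: path_edges_append)
  qed
qed

text \<open>No separation of order at most one. Order zero is included, so this entails
  connectedness; for a finite graph with at least three vertices it is 2-connectedness.\<close>

definition nonseparable :: "'v set \<Rightarrow> 'v set set \<Rightarrow> bool" where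
  "nonseparable V E \<longleftrightarrow> (\<forall>V1 V2. V1 \<union> V2 = V \<longrightarrow> V1 - V2 \<noteq> {} \<longrightarrow> V2 - V1 \<noteq> {} \<longrightarrow>
     card (V1 \<inter> V2) \<le> 1 \<longrightarrow> (\<exists>e\<in>E. \<not> e \<subseteq> V1 \<and> \<not> e \<subseteq> V2))"

lemma two_distinct:
  assumes "finite A" "\<not> card A \<le> 1"
  obtains a b where "a \<in> A" "b \<in> A" "a \<noteq> b"
  using assms by (metis card_le_Suc0_iff_eq One_nat_def)

text \<open>All neighbours of the first vertex \<open>v\<close> of a longest path lie on that path.
  There are at least two of them, and one that is not the second vertex of the path closes a
  cycle.\<close>

lemma nonseparable_cycle_exists:
  assumes "finite V" and E: "\<And>e. e \<in> E \<Longrightarrow> e \<subseteq> V \<and> card e = 2"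
    and V: "3 \<le> card V" and ns: "nonseparable V E"
  shows "\<exists>cs. distinct cs \<and> 3 \<le> length cs \<and> path_edges (cs @ [hd cs]) \<subseteq> E"
proof -
  let ?path = "\<lambda>xs. distinct xs \<and> set xs \<subseteq> V \<and> path_edges xs \<subseteq> E \<and> xs \<noteq> []"
  obtain v0 where "v0 \<in> V" using V by fastforce
  then have "?path [v0]" by simp
  moreover have "length xs < Suc (card V)" if "?path xs" for xs
    using that card_mono[OF assms(1), of "set xs"] by (simp add: distinct_card)
  ultimately obtain xs where xs: "?path xs" "\<And>ys. ?path ys \<Longrightarrow> length ys \<le> length xs"
    using ex_has_greatest_nat[of ?path "[v0]" length "Suc (card V)"] by blast
  then obtain v ys where vys: "xs = v # ys" by (cases xs) auto
  define N where "N = {u. {v, u} \<in> E}"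
  have NV: "N \<subseteq> V" using E by (auto simp: N_def)
  then have fN: "finite N" using assms(1) finite_subset by blast
  have vV: "v \<in> V" using xs vys by auto
  have vN: "v \<notin> N" using E by (force simp: N_def)
  have Nys: "N \<subseteq> set ys"
  proof
    fix u assume u: "u \<in> N"
    show "u \<in> set ys"
    proof (rule ccontr)
      assume "u \<notin> set ys"
      moreover have "u \<noteq> v" "u \<in> V" using u vN NV by auto
      moreover have "{u, v} \<in> E" using u by (simp add: N_def insert_commute)
      ultimately have "?path (u # xs)" using xs(1) by (simp add: vys)
      then show False using xs(2) by fastforce
    qed
  qed
  have "\<not> card N \<le> 1"
  proof
    assume cN: "card N \<le> 1"
    \<comment> \<open>With at most one neighbour, \<open>insert v N\<close> and
      \<open>V - {v}\<close> would form a separation. It is proper because \<open>V\<close> has at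
      least three vertices.\<close>
    have "card (insert v N) \<le> 2" using cN card_insert_le_m1[of 2 N v] by simp
    then have "\<not> V \<subseteq> insert v N" using V fN card_mono[of "insert v N" V] by auto
    then have "(V - {v}) - insert v N \<noteq> {}" "insert v N - (V - {v}) \<noteq> {}" "insert v N \<union> (V - {v}) = V"
      using NV vV by auto
    moreover have "insert v N \<inter> (V - {v}) = N" using NV vN by auto
    ultimately obtain e where e: "e \<in> E" "\<not> e \<subseteq> insert v N" "\<not> e \<subseteq> V - {v}"
      using ns cN unfolding nonseparable_def by metis
    then have "v \<in> e" "card e = 2" using E by auto
    then obtain u where "e = {v, u}" by (auto simp: card_2_iff)
    then show False using e by (auto simp: N_def)
  qed
  then obtain a b where "a \<in> N" "b \<in> N" "a \<noteq> b" using fN two_distinct by metis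
  then obtain u where u: "u \<in> N" "u \<noteq> hd ys" by metis
  then obtain Y1 Y2 where Y: "ys = Y1 @ u # Y2" using Nys by (meson split_list subsetD)
  then have "Y1 \<noteq> []" using u by auto
  moreover have "{u, v} \<in> E" using u by (simp add: N_def insert_commute)
  moreover have "path_edges (v # Y1 @ [u]) \<subseteq> E"
    using xs(1) path_edges_append[of "v # Y1 @ [u]" Y2] unfolding vys Y by auto
  then have "path_edges ((v # Y1 @ [u]) @ [v]) \<subseteq> E"
    using \<open>{u, v} \<in> E\<close> by (subst path_edges_append) auto
  moreover have "distinct (v # Y1 @ [u])" using xs(1) unfolding vys Y by auto
  moreover have "3 \<le> length (v # Y1 @ [u])" using \<open>Y1 \<noteq> []\<close> by (cases Y1) auto
  moreover have "hd (v # Y1 @ [u]) = v" by simp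
  ultimately show ?thesis by metis
qed

text \<open>A component \<open>H\<close> off a longest cycle has two attachments on the cycle,
  joined by a path through \<open>H\<close>. If both arcs between the attachments have interior
  vertices, the three paths form a fat theta. Otherwise an arc is a single edge, and the detour
  through \<open>H\<close> gives a longer cycle.\<close>

lemma nonseparable_hamiltonian:
  assumes "finite V" and E: "\<And>e. e \<in> E \<Longrightarrow> e \<subseteq> V \<and> card e = 2"
    and V: "3 \<le> card V" and ns: "nonseparable V E" and free: "fat_theta_free E"
  shows "\<exists>cs. distinct cs \<and> set cs = V \<and> path_edges (cs @ [hd cs]) \<subseteq> E"
proof -
  let ?cyc = "\<lambda>cs. distinct cs \<and> 3 \<le> length cs \<and> path_edges (cs @ [hd cs]) \<subseteq> E"
  have cycV: "set cs \<subseteq> V" if "?cyc cs" for cs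
  proof
    fix v assume "v \<in> set cs"
    moreover have "2 \<le> length (cs @ [hd cs])" using that by simp
    ultimately obtain e where "e \<in> path_edges (cs @ [hd cs])" "v \<in> e"
      using path_edges_cover[of "cs @ [hd cs]" v] by auto
    then show "v \<in> V" using that E by blast
  qed
  obtain cs0 where "?cyc cs0" using nonseparable_cycle_exists[OF assms(1-4)] by blast
  moreover have "length cs < Suc (card V)" if "?cyc cs" for cs
    using that card_mono[OF assms(1) cycV[OF that]] by (simp add: distinct_card)
  ultimately obtain cs where cs: "?cyc cs" and longest: "\<And>ds. ?cyc ds \<Longrightarrow> length ds \<le> length cs"
    using ex_has_greatest_nat[of ?cyc cs0 length "Suc (card V)"] by blast
  have "set cs = V"
  proof (rule ccontr)
    assume "set cs \<noteq> V"
    then obtain u where u: "u \<in> V" "u \<notin> set cs" using cycV[OF cs] by blast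
    define r where "r = {(a, b). {a, b} \<in> E \<and> a \<notin> set cs \<and> b \<notin> set cs}"
    define H where "H = {h. (u, h) \<in> r\<^sup>*}"
    define A where "A = {c \<in> set cs. \<exists>h\<in>H. {h, c} \<in> E}"
    have HC: "h \<notin> set cs \<and> h \<in> V" if "h \<in> H" for h
      using that unfolding H_def mem_Collect_eq
    proof (induction rule: rtrancl_induct)
      case (step y z)
      then show ?case using E[of "{y, z}"] by (auto simp: r_def)
    qed (use u in auto)
    have uH: "u \<in> H" by (simp add: H_def)
    have cc: "card (set cs) \<ge> 3" using cs by (simp add: distinct_card)
    have Acs: "A \<subseteq> set cs" by (auto simp: A_def)
    then have fA: "finite A" using finite_subset by blast
    \<comment> \<open>Edges leave \<open>H\<close> only towards \<open>A\<close>, so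
      \<open>H \<union> A\<close> and \<open>V - H\<close> form a separation whose overlap is
      \<open>A\<close>.\<close>
    have "\<not> card A \<le> 1"
    proof
      assume cA: "card A \<le> 1"
      then have "\<not> set cs \<subseteq> A" using cc fA card_mono[of A "set cs"] by auto
      then have "(V - H) - (H \<union> A) \<noteq> {}" using cycV[OF cs] HC by blast
      moreover have "(H \<union> A) - (V - H) \<noteq> {}" using uH by auto
      moreover have "(H \<union> A) \<union> (V - H) = V" "(H \<union> A) \<inter> (V - H) = A"
        using HC Acs cycV[OF cs] by blast+
      ultimately obtain e where e: "e \<in> E" "\<not> e \<subseteq> H \<union> A" "\<not> e \<subseteq> V - H"
        using ns cA unfolding nonseparable_def by metis
      then obtain h where h: "h \<in> e" "h \<in> H" using E by blast
      then obtain w where w: "e = {h, w}" using E[OF e(1)] by (auto simp: card_2_iff)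
      have "w \<in> H \<union> A"
      proof (cases "w \<in> set cs")
        case True
        then show ?thesis using h w e by (auto simp: A_def)
      next
        case False
        then have "(h, w) \<in> r" using h HC w e by (auto simp: r_def)
        then show ?thesis using h by (auto simp: H_def)
      qed
      then show False using e w h by auto
    qed
    then obtain c c' where c: "c \<in> A" "c' \<in> A" "c \<noteq> c'" using fA two_distinct by metis
    then obtain h h' where h: "h \<in> H" "h' \<in> H" "{h, c} \<in> E" "{h', c'} \<in> E" by (auto simp: A_def)
    have "sym r" by (auto simp: sym_def r_def insert_commute)
    then have "(h, u) \<in> r\<^sup>*" using h(1) by (metis H_def mem_Collect_eq sym_rtrancl symD)
    moreover have "(u, h') \<in> r\<^sup>*" using h(2) unfolding H_def by simp
    ultimately have hh': "(h, h') \<in> r\<^sup>*" by (rule rtrancl_trans)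
    have "h \<notin> set cs" using HC[OF h(1)] by simp
    then obtain P where P: "P \<noteq> []" "hd P = h" "last P = h'" "distinct P" "path_edges P \<subseteq> E" "set P \<inter> set cs = {}"
      using rtrancl_path[OF hh'[unfolded r_def]] by blast
    \<comment> \<open>The cycle is rotated to start at \<open>c\<close>; then \<open>c'\<close>
      splits the rest into the interiors \<open>A'\<close> and \<open>B\<close> of the two
      arcs.\<close>
    obtain C1 C2 where C12: "cs = C1 @ c # C2" using c(1) Acs by (meson split_list subsetD)
    have "c' \<in> set (C2 @ C1)" using c Acs C12 by auto
    then obtain A' B where AB: "C2 @ C1 = A' @ c' # B" by (meson split_list)
    have "path_edges (c # (C2 @ C1) @ [c]) \<subseteq> path_edges (cs @ [hd cs])"
      unfolding C12 by (cases C1; cases C2) (auto simp: path_edges_append path_edges_Cons)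
    then have "path_edges (c # (C2 @ C1) @ [c]) \<subseteq> E" using cs by blast
    moreover have "path_edges (c # (C2 @ C1) @ [c]) = path_edges (c # A' @ [c']) \<union> path_edges (c' # B @ [c])"
      using path_edges_append[of "c # A' @ [c']" "B @ [c]"] path_edges_Cons[of c' "B @ [c]"] unfolding AB by auto
    ultimately have pe: "path_edges (c # A' @ [c']) \<subseteq> E" "path_edges (c' # B @ [c]) \<subseteq> E" by auto
    have set_cs: "set cs = insert c (insert c' (set A' \<union> set B))"
    proof -
      have "set cs = insert c (set (C2 @ C1))" by (auto simp: C12)
      then show ?thesis unfolding AB by auto
    qed
    have len: "length cs = length A' + length B + 2"
      using arg_cong[OF AB, of length] by (simp add: C12)
    have "distinct (c # C2 @ C1)" using cs by (auto simp: C12)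
    then have dist: "distinct (c # c' # A' @ B)" unfolding AB by auto
    have cP: "path_edges (c # P @ [c']) \<subseteq> E"
      using P h by (auto simp: path_edges_append path_edges_Cons insert_commute)
    have revB: "path_edges (c # rev B @ [c']) \<subseteq> E" and revP: "path_edges (c' # rev P @ [c]) \<subseteq> E"
      using pe(2) cP path_edges_rev[of "c' # B @ [c]"] path_edges_rev[of "c # P @ [c']"] by auto
    have lenP: "length P > 0" using P by simp
    show False
    proof (cases "A' = [] \<or> B = []")
      case False
      then have "fat_theta E c c' P A' (rev B)"
        using dist P set_cs cP pe(1) revB by (auto simp: fat_theta_def theta_def)
      then show False using free by (auto simp: fat_theta_free_def)
    next
      case True
      then show False
      proof
        assume A: "A' = []"
        have "?cyc (c # P @ c' # B)"
          using dist P set_cs cP pe(2) lenP path_edges_append[of "c # P @ [c']" "B @ [c]"] path_edges_Cons[of c' "B @ [c]"]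
          by (auto simp: Suc_le_eq)
        then show False using longest[of "c # P @ c' # B"] len A lenP by simp
      next
        assume B: "B = []"
        have "?cyc (c # A' @ c' # rev P)"
          using dist P set_cs revP pe(1) lenP path_edges_append[of "c # A' @ [c']" "rev P @ [c]"] path_edges_Cons[of c' "rev P @ [c]"]
          by (auto simp: Suc_le_eq)
        then show False using longest[of "c # A' @ c' # rev P"] len B lenP by simp
      qed
    qed
  qed
  then show ?thesis using cs by blast
qed

lemma fat_theta_mono: "fat_theta E x y P Q R \<Longrightarrow> E \<subseteq> F \<Longrightarrow> fat_theta F x y P Q R"
  by (auto simp: fat_theta_def theta_def)

text \<open>Strong induction on the number of vertices. Both exclusions pass to the two parts of a
  separation, whose orders are glued; a nonseparable graph is ordered by its Hamiltonian cycle, and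
  fewer than three vertices admit no crossing.\<close>

theorem noncrossing_order_exists:
  assumes "finite V" "\<And>e. e \<in> E \<Longrightarrow> e \<subseteq> V \<and> card e = 2" "fat_theta_free E" "K4_free E"
  shows "\<exists>vs. distinct vs \<and> set vs = V \<and> noncrossing E vs"
  using assms
proof (induction "card V" arbitrary: V E rule: less_induct)
  case less
  note fin = less.prems(1) and E = less.prems(2) and free = less.prems(3,4)
  consider "card V < 3" | "3 \<le> card V" "nonseparable V E" | "\<not> nonseparable V E" by linarith
  then show ?case
  proof cases
    case 1
    obtain vs where vs: "distinct vs" "set vs = V" using finite_distinct_list[OF fin] by blast
    then have "length vs < 3" using 1 distinct_card by fastforce
    then have "noncrossing E vs" by (auto simp: noncrossing_def)
    then show ?thesis using vs by blast
  next
    case 2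
    then show ?thesis
      using nonseparable_hamiltonian[OF fin E _ _ free(1)] noncrossing_hamiltonian free by blast
  next
    case 3
    then obtain V1 V2 where V12: "V1 \<union> V2 = V" "V1 - V2 \<noteq> {}" "V2 - V1 \<noteq> {}" "card (V1 \<inter> V2) \<le> 1"
      and e12: "\<And>e. e \<in> E \<Longrightarrow> e \<subseteq> V1 \<or> e \<subseteq> V2"
      unfolding nonseparable_def by blast
    have order: "\<exists>vs. distinct vs \<and> set vs = W \<and> noncrossing {e \<in> E. e \<subseteq> W} vs" if "W \<subset> V" for W
    proof (rule less.hyps)
      show "card W < card V" "finite W" using that fin by (auto intro: psubset_card_mono finite_subset)
      show "fat_theta_free {e \<in> E. e \<subseteq> W}"
        using free(1) fat_theta_mono[of "{e \<in> E. e \<subseteq> W}"] by (fastforce simp: fat_theta_free_def)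
      show "K4_free {e \<in> E. e \<subseteq> W}"
        using free(2) unfolding K4_free_def mem_Collect_eq by meson
    qed (use E in auto)
    have "V1 \<subset> V" "V2 \<subset> V" using V12 by auto
    then obtain vs1 vs2 where vs: "distinct vs1" "set vs1 = V1" "noncrossing {e \<in> E. e \<subseteq> V1} vs1"
      "distinct vs2" "set vs2 = V2" "noncrossing {e \<in> E. e \<subseteq> V2} vs2"
      using order by meson
    have "{e \<in> E. e \<subseteq> V1} \<union> {e \<in> E. e \<subseteq> V2} = E" using e12 by blast
    moreover have "\<exists>vs. distinct vs \<and> set vs = set vs1 \<union> set vs2 \<and>
        noncrossing ({e \<in> E. e \<subseteq> V1} \<union> {e \<in> E. e \<subseteq> V2}) vs"
      using vs(2,5) V12(4) by (intro noncrossing_separation[OF vs(1,3) _ vs(4,6)]) auto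
    ultimately show ?thesis using vs(2,5) V12(1) by simp
  qed
qed

subsection \<open>Graphs with a fat theta\<close>

lemma path_edges_subset_iff:
  "path_edges (xs @ ys) \<subseteq> E \<longleftrightarrow> path_edges xs \<subseteq> E \<and> path_edges ys \<subseteq> E \<and> (xs \<noteq> [] \<longrightarrow> ys \<noteq> [] \<longrightarrow> {last xs, hd ys} \<in> E)"
  "path_edges (x # xs) \<subseteq> E \<longleftrightarrow> path_edges xs \<subseteq> E \<and> (xs \<noteq> [] \<longrightarrow> {x, hd xs} \<in> E)"
  by (auto simp: path_edges_append path_edges_Cons)

lemma subset_singleton_trans: "a \<in> U \<Longrightarrow> X \<subseteq> {a} \<Longrightarrow> X \<subseteq> U"
  by auto

lemma hd_neq_last: "distinct xs \<Longrightarrow> 2 \<le> length xs \<Longrightarrow> hd xs \<noteq> last xs"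
  by (cases xs) auto

text \<open>Wheels and prisms have numbered vertices, so indexing into lists gives a map from the
  model to \<open>G\<close>. The embedding is the inverse of that map.\<close>

lemma isomorphic_to_subgraph_inv:
  assumes inj: "inj_on g D" and V: "verts G = g ` D" and D: "D \<subseteq> verts H"
    and E: "\<And>e. e \<in> edges G \<Longrightarrow> \<exists>d. d \<subseteq> D \<and> d \<in> edges H \<and> e = g ` d"
  shows "isomorphic_to_subgraph G H"
  unfolding isomorphic_to_subgraph_def
proof (intro exI conjI)
  let ?f = "inv_into D g"
  show "inj_on ?f (verts G)" unfolding V by (rule inj_on_inv_into) simp
  show "?f ` verts G \<subseteq> verts H" unfolding V using D inj by auto
  show "(`) ?f ` edges G \<subseteq> edges H"
  proof
    fix e' assume "e' \<in> (`) ?f ` edges G"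
    then obtain e where e: "e \<in> edges G" "e' = ?f ` e" by auto
    then obtain d where d: "d \<subseteq> D" "d \<in> edges H" "e = g ` d" using E by blast
    then have "e' = d" using e inj by (simp add: inv_into_image_cancel)
    then show "e' \<in> edges H" using d by simp
  qed
qed

lemma subgraph_of_wheel:
  assumes cs: "distinct cs" "3 \<le> length cs" "h \<notin> set cs" and V: "verts G = insert h (set cs)"
    and E: "edges G \<subseteq> path_edges (cs @ [hd cs]) \<union> {{h, v} | v. v \<in> set cs}"
  shows "isomorphic_to_subgraph G (wheel (length cs))"
proof (rule isomorphic_to_subgraph_inv)
  let ?n = "length cs"
  let ?g = "\<lambda>i. if i = ?n then h else cs ! i"
  show "inj_on ?g {..?n}"
    using cs by (auto simp: inj_on_def nth_eq_iff_index_eq)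
  have "?g ` {..?n} = insert h ((!) cs ` {..<?n})" by (auto simp: image_def le_less)
  then show "verts G = ?g ` {..?n}" using V by (auto simp: set_conv_nth)
  show "{..?n} \<subseteq> verts (wheel ?n)" by (simp add: wheel_def)
  fix e assume "e \<in> edges G"
  then consider "e \<in> cycle_edges cs" | "\<exists>v\<in>set cs. e = {h, v}"
    using E cs cycle_edges_conv_path_edges[of cs] by fastforce
  then show "\<exists>d\<subseteq>{..?n}. d \<in> edges (wheel ?n) \<and> e = ?g ` d"
  proof cases
    case 1
    then obtain i where i: "i < ?n" "e = {cs ! i, cs ! (Suc i mod ?n)}" by (auto simp: cycle_edges_def)
    then have "Suc i mod ?n < ?n" by (intro mod_less_divisor) linarith
    then show ?thesis using i
      by (intro exI[of _ "{i, Suc i mod ?n}"]) (auto simp: wheel_def)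
  next
    case 2
    then obtain i where i: "i < ?n" "e = {h, cs ! i}" by (auto simp: in_set_conv_nth)
    then show ?thesis
      by (intro exI[of _ "{i, ?n}"]) (auto simp: wheel_def)
  qed
qed

text \<open>\<open>S i\<close> lists the whole \<open>i\<close>-th side path, triangle corners
  included: its head lies on one triangle and its last vertex on the other. Its number of edges is
  therefore \<open>length (S i) - 1\<close>.\<close>

lemma subgraph_of_prism_indexed:
  assumes len: "\<And>i. i < 3 \<Longrightarrow> 2 \<le> length (S i)" and d: "\<And>i. i < 3 \<Longrightarrow> distinct (S i)"
    and disj: "\<And>i k. i < 3 \<Longrightarrow> k < 3 \<Longrightarrow> i \<noteq> k \<Longrightarrow> set (S i) \<inter> set (S k) = {}"
    and V: "verts G = (\<Union>i<3. set (S i))"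
    and E: "edges G \<subseteq> (\<Union>i<3. path_edges (S i)) \<union> {{hd (S i), hd (S k)} | i k. i < 3 \<and> k < 3 \<and> i \<noteq> k}
      \<union> {{last (S i), last (S k)} | i k. i < 3 \<and> k < 3 \<and> i \<noteq> k}"
  shows "isomorphic_to_subgraph G (elongated_prism (\<lambda>i. length (S i) - 1))"
proof (rule isomorphic_to_subgraph_inv)
  define l where "l i = length (S i) - 1" for i
  define D where "D = {(i, j). i < 3 \<and> j \<le> l i}"
  define g where "g = (\<lambda>(i, j). S i ! j)"
  have jl: "j \<le> l i \<longleftrightarrow> j < length (S i)" if "i < 3" for i j
    using len[OF that] by (auto simp: l_def)
  show "inj_on g D"
  proof (rule inj_onI)
    fix s t assume st: "s \<in> D" "t \<in> D" "g s = g t"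
    obtain i j k m where ij: "s = (i, j)" "t = (k, m)" by fastforce
    then have *: "i < 3" "k < 3" "j < length (S i)" "m < length (S k)" "S i ! j = S k ! m"
      using st jl by (auto simp: D_def g_def)
    then have "i = k" using disj[of i k] by (metis disjoint_iff nth_mem)
    then show "s = t" using * d ij by (simp add: nth_eq_iff_index_eq)
  qed
  show "verts G = g ` D"
  proof
    show "verts G \<subseteq> g ` D"
    proof
      fix v assume "v \<in> verts G"
      then obtain i where "i < 3" "v \<in> set (S i)" using V by auto
      then obtain j where "j < length (S i)" "S i ! j = v" by (auto simp: in_set_conv_nth)
      then show "v \<in> g ` D" using \<open>i < 3\<close> jl by (auto simp: D_def g_def intro!: image_eqI[of _ _ "(i, j)"])
    qed
    show "g ` D \<subseteq> verts G" using V jl by (auto simp: D_def g_def)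
  qed
  let ?H = "elongated_prism (\<lambda>i. length (S i) - 1)"
  have H: "?H = elongated_prism l" by (simp add: l_def[abs_def])
  show "D \<subseteq> verts ?H" unfolding H by (auto simp: D_def elongated_prism_def)
  fix e assume "e \<in> edges G"
  then have "e \<in> (\<Union>i<3. path_edges (S i)) \<or> e \<in> {{hd (S i), hd (S k)} | i k. i < 3 \<and> k < 3 \<and> i \<noteq> k}
      \<or> e \<in> {{last (S i), last (S k)} | i k. i < 3 \<and> k < 3 \<and> i \<noteq> k}"
    using E by blast
  then consider i where "i < 3" "e \<in> path_edges (S i)"
    | i k where "i < 3" "k < 3" "i \<noteq> k" "e = {hd (S i), hd (S k)}"
    | i k where "i < 3" "k < 3" "i \<noteq> k" "e = {last (S i), last (S k)}"
    unfolding UN_iff mem_Collect_eq Bex_def lessThan_iff by blast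
  then show "\<exists>d\<subseteq>D. d \<in> edges ?H \<and> e = g ` d"
    unfolding H
  proof cases
    case 1
    then obtain j where j: "Suc j < length (S i)" "e = {S i ! j, S i ! Suc j}"
      by (auto simp: path_edges_conv_nth)
    then have "j < l i" by (simp add: l_def)
    then show "\<exists>d\<subseteq>D. d \<in> edges (elongated_prism l) \<and> e = g ` d" using 1 j
      by (intro exI[of _ "{(i, j), (i, Suc j)}"]) (auto simp: D_def g_def elongated_prism_def)
  next
    case 2
    have "hd (S m) = S m ! 0" if "m < 3" for m using len[OF that] by (intro hd_conv_nth) auto
    then show "\<exists>d\<subseteq>D. d \<in> edges (elongated_prism l) \<and> e = g ` d" using 2
      by (intro exI[of _ "{(i, 0), (k, 0)}"]) (auto simp: D_def g_def elongated_prism_def)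
  next
    case 3
    have "last (S m) = S m ! l m" if "m < 3" for m
      unfolding l_def using len[OF that] by (intro last_conv_nth) auto
    then show "\<exists>d\<subseteq>D. d \<in> edges (elongated_prism l) \<and> e = g ` d" using 3
      by (intro exI[of _ "{(i, l i), (k, l k)}"]) (auto simp: D_def g_def elongated_prism_def)
  qed
qed

definition wheel_or_prism :: "'v graph \<Rightarrow> bool" where
  "wheel_or_prism G \<longleftrightarrow> (\<exists>n\<ge>3. isomorphic_to_subgraph G (wheel n)) \<or>
     (\<exists>l. (\<forall>i<3. 1 \<le> l i) \<and> isomorphic_to_subgraph G (elongated_prism l))"

lemma wheelI:
  assumes "distinct (h # cs)" "3 \<le> length cs" "verts G = insert h (set cs)"
    and "edges G \<subseteq> path_edges (cs @ [hd cs]) \<union> {{h, v} | v. v \<in> set cs}"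
  shows "wheel_or_prism G"
  using subgraph_of_wheel[of cs h G] assms by (auto simp: wheel_or_prism_def)

lemma prismI:
  assumes len: "2 \<le> length A" "2 \<le> length B" "2 \<le> length C" and d: "distinct (A @ B @ C)"
    and V: "verts G = set A \<union> set B \<union> set C"
    and E: "edges G \<subseteq> path_edges A \<union> path_edges B \<union> path_edges C
      \<union> {{hd A, hd B}, {hd A, hd C}, {hd B, hd C}} \<union> {{last A, last B}, {last A, last C}, {last B, last C}}"
  shows "wheel_or_prism G"
proof -
  define S where "S i = (if i = 0 then A else if i = 1 then B else C)" for i :: nat
  have S: "S 0 = A" "S 1 = B" "S 2 = C" by (simp_all add: S_def)
  have less3: "i < 3 \<longleftrightarrow> i = 0 \<or> i = 1 \<or> i = 2" for i :: nat by auto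
  have U: "(\<Union>i<3. f (S i)) = f A \<union> f B \<union> f C" for f :: "'a list \<Rightarrow> 'b set"
  proof -
    have "{..<3} = {0, 1, 2 :: nat}" by auto
    then show ?thesis by (simp only: S UN_insert UN_empty Un_empty_right Un_assoc)
  qed
  have "isomorphic_to_subgraph G (elongated_prism (\<lambda>i. length (S i) - 1))"
  proof (rule subgraph_of_prism_indexed)
    show "verts G = (\<Union>i<3. set (S i))" using V by (simp add: U)
    have pair: "{f (S i), f (S k)} \<in> {{f (S i), f (S k)} | i k. i < 3 \<and> k < 3 \<and> i \<noteq> k}"
      if "i < 3" "k < 3" "i \<noteq> k" for f :: "'a list \<Rightarrow> 'a" and i k
      unfolding mem_Collect_eq using that by (intro exI[of _ i] exI[of _ k]) simp
    have "{{hd A, hd B}, {hd A, hd C}, {hd B, hd C}} \<subseteq> {{hd (S i), hd (S k)} | i k. i < 3 \<and> k < 3 \<and> i \<noteq> k}"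
      using pair[of 0 1 hd] pair[of 0 2 hd] pair[of 1 2 hd] by (simp only: S insert_subset) simp
    moreover have "{{last A, last B}, {last A, last C}, {last B, last C}} \<subseteq> {{last (S i), last (S k)} | i k. i < 3 \<and> k < 3 \<and> i \<noteq> k}"
      using pair[of 0 1 last] pair[of 0 2 last] pair[of 1 2 last] by (simp only: S insert_subset) simp
    ultimately show "edges G \<subseteq> (\<Union>i<3. path_edges (S i)) \<union> {{hd (S i), hd (S k)} | i k. i < 3 \<and> k < 3 \<and> i \<noteq> k}
      \<union> {{last (S i), last (S k)} | i k. i < 3 \<and> k < 3 \<and> i \<noteq> k}"
      unfolding U by (rule order_trans[OF E Un_mono[OF Un_mono[OF order_refl]]])
  qed (use len d in \<open>auto simp: less3 S_def\<close>)
  moreover have "\<forall>i<3. 1 \<le> length (S i) - 1" using len by (auto simp: less3 S_def)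
  ultimately show ?thesis by (auto simp: wheel_or_prism_def)
qed

section \<open>Chords of a spanning theta\<close>

lemma fat_theta_perm:
  "fat_theta E x y P Q R \<Longrightarrow> fat_theta E x y Q P R" "fat_theta E x y P Q R \<Longrightarrow> fat_theta E x y P R Q"
  by (auto simp: fat_theta_def theta_def)

lemma fat_theta_rev: "fat_theta E x y P Q R \<Longrightarrow> fat_theta E y x (rev P) (rev Q) (rev R)"
  using path_edges_rev[of "x # P @ [y]"] path_edges_rev[of "x # Q @ [y]"] path_edges_rev[of "x # R @ [y]"]
  by (auto simp: fat_theta_def theta_def)

text \<open>Both facts are required for every fat theta of \<open>G\<close>, because the arguments
  below apply them to new thetas built from a given one and its chords.\<close>

locale theta_graph =
  fixes G :: "'v graph"
  assumes simple: "finite_simple_graph G"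
    and spanning: "fat_theta (edges G) x y P Q R \<Longrightarrow> verts G = {x, y} \<union> set P \<union> set Q \<union> set R"
    and nonadjacent: "fat_theta (edges G) x y P Q R \<Longrightarrow> {x, y} \<notin> edges G"
begin

lemma edge_ends: "e \<in> edges G \<Longrightarrow> \<exists>u v. e = {u, v} \<and> u \<noteq> v \<and> u \<in> verts G \<and> v \<in> verts G"
  using simple by (fastforce simp: finite_simple_graph_def card_2_iff)

text \<open>Both thetas contain all vertices and differ only in one path, so rerouting that path
  cannot lose a vertex.\<close>

lemma shorter_path:
  assumes "fat_theta (edges G) x y P Q R" "fat_theta (edges G) x y P' Q R"
  shows "set P \<subseteq> set P'"
  using spanning[OF assms(1)] spanning[OF assms(2)] assms(1)
  by (auto simp: fat_theta_def theta_def)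

text \<open>The chord from \<open>u\<close> to \<open>v\<close> is a shortcut past \<open>B\<close>.
  By \<open>shorter_path\<close> a rerouted path loses no vertex, so nothing is bypassed.\<close>

lemma ordered_path_chord:
  assumes th: "fat_theta (edges G) x y P Q R" and e: "{u, v} \<in> edges G"
    and split: "x # P @ [y] = A @ u # B @ v # C"
  shows "B = []"
proof (rule ccontr)
  assume B: "B \<noteq> []"
  have th': "distinct (x # y # P @ Q @ R)" "path_edges (x # P @ [y]) \<subseteq> edges G" "P \<noteq> []"
    using th by (auto simp: fat_theta_def theta_def)
  have hd_last: "hd (A @ u # v # C) = x" "last (A @ u # v # C) = y"
    using arg_cong[OF split, of hd] arg_cong[OF split, of last] by (auto simp: hd_append)
  \<comment> \<open>The chord is not \<open>{x, y}\<close>, so the shortened path keeps an interior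
    vertex and the theta stays fat.\<close>
  have "\<not> (A = [] \<and> C = [])" using nonadjacent[OF th] e hd_last by auto
  have "\<exists>P'. A @ u # v # C = x # P' @ [y]"
    using hd_last
    by (cases A; cases C rule: rev_cases) (auto simp: Cons_eq_append_conv append_eq_Cons_conv)
  then obtain P' where P': "A @ u # v # C = x # P' @ [y]" by blast
  have "P' \<noteq> []"
  proof
    assume "P' = []"
    then have "length (A @ u # v # C) = 2" by (simp add: P')
    then show False using \<open>\<not> (A = [] \<and> C = [])\<close> by auto
  qed
  moreover have dA: "distinct (A @ u # B @ v # C)"
    using th'(1) unfolding split[symmetric] by auto
  then have "distinct (A @ u # v # C)" by auto
  then have "distinct (x # P' @ [y])" unfolding P' .
  moreover have "set P' \<subseteq> set P"
  proof -
    have "set (A @ u # v # C) \<subseteq> set (x # P @ [y])" unfolding split by auto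
    then show ?thesis using \<open>distinct (x # P' @ [y])\<close> unfolding P' by auto
  qed
  moreover have "path_edges (x # P' @ [y]) \<subseteq> edges G"
    using th'(2) e unfolding P'[symmetric] split by (auto simp: path_edges_subset_iff split: if_splits)
  ultimately have "fat_theta (edges G) x y P' Q R"
    using th by (auto simp: fat_theta_def theta_def)
  then have "set P \<subseteq> set P'" using shorter_path th by blast
  then have "set (A @ u # B @ v # C) \<subseteq> set (A @ u # v # C)"
    unfolding P' split[symmetric] by auto
  then show False using dA B by (cases B) auto
qed

lemma path_chord:
  assumes "fat_theta (edges G) x y P Q R" "e \<in> edges G" "e \<subseteq> set (x # P @ [y])"
  shows "e \<in> path_edges (x # P @ [y])"
proof -
  obtain u v where uv: "e = {u, v}" "u \<noteq> v" using edge_ends assms(2) by blast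
  have split: "\<exists>A B C. xs = A @ a # B @ b # C \<or> xs = A @ b # B @ a # C"
    if "a \<in> set xs" "b \<in> set xs" "a \<noteq> b" for a b and xs :: "'v list"
  proof -
    note ab = that
    obtain A C where AC: "xs = A @ a # C" using ab by (meson split_list)
    then consider "b \<in> set A" | "b \<in> set C" using ab by auto
    then show ?thesis
    proof cases
      case 1
      then obtain A1 A2 where "A = A1 @ b # A2" by (meson split_list)
      then have "xs = A1 @ b # A2 @ a # C" using AC by simp
      then show ?thesis by blast
    next
      case 2
      then obtain C1 C2 where "C = C1 @ b # C2" by (meson split_list)
      then show ?thesis using AC by blast
    qed
  qed
  have "u \<in> set (x # P @ [y])" "v \<in> set (x # P @ [y])" using assms(3) uv by auto
  then obtain A B C where ABC: "x # P @ [y] = A @ u # B @ v # C \<or> x # P @ [y] = A @ v # B @ u # C"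
    using split uv(2) by meson
  have "{u, v} \<in> edges G" "{v, u} \<in> edges G" using assms(2) uv by (simp_all add: insert_commute)
  then have "B = []" using ABC ordered_path_chord[OF assms(1)] by metis
  then show ?thesis using ABC uv by (auto simp: path_edges_append insert_commute)
qed

text \<open>\<open>x\<close> and \<open>y\<close> belong to all three paths, so an edge at one of
  them has both ends on a single path and \<open>path_chord\<close> places it on the theta.\<close>

lemma edge_cases:
  assumes th: "fat_theta (edges G) x y P Q R" and e: "e \<in> edges G"
  obtains "e \<in> path_edges (x # P @ [y]) \<union> path_edges (x # Q @ [y]) \<union> path_edges (x # R @ [y])"
    | u w where "u \<in> set P" "w \<in> set Q" "e = {u, w}"
    | u w where "u \<in> set P" "w \<in> set R" "e = {u, w}"
    | u w where "u \<in> set Q" "w \<in> set R" "e = {u, w}"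
proof -
  obtain u v where uv: "e = {u, v}" "u \<in> verts G" "v \<in> verts G" using edge_ends e by blast
  have vu: "e = {v, u}" using uv by auto
  show thesis
  proof (cases "e \<subseteq> set (x # P @ [y]) \<or> e \<subseteq> set (x # Q @ [y]) \<or> e \<subseteq> set (x # R @ [y])")
    case True
    then have "e \<in> path_edges (x # P @ [y]) \<union> path_edges (x # Q @ [y]) \<union> path_edges (x # R @ [y])"
      using path_chord[OF th e] path_chord[OF fat_theta_perm(1)[OF th] e]
        path_chord[OF fat_theta_perm(1)[OF fat_theta_perm(2)[OF th]] e] by blast
    then show thesis by (rule that(1))
  next
    case False
    then have "u \<in> set P \<and> v \<in> set Q \<or> v \<in> set P \<and> u \<in> set Q \<or> u \<in> set P \<and> v \<in> set R \<or>
        v \<in> set P \<and> u \<in> set R \<or> u \<in> set Q \<and> v \<in> set R \<or> v \<in> set Q \<and> u \<in> set R"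
      using uv unfolding spanning[OF th] by auto
    then show thesis using that(2-4) uv(1) vu by metis
  qed
qed

text \<open>Otherwise omitting the part of the first path between \<open>x\<close> and \<open>u\<close> would leave a fat theta
  with branch vertices \<open>y\<close> and \<open>w\<close> that does not span.\<close>

lemma chord_start:
  assumes th: "fat_theta (edges G) x y (P1 @ u # P2) (Q1 @ w # Q2) R" and e: "{u, w} \<in> edges G"
    and Q2: "Q2 \<noteq> []"
  shows "P1 = []"
proof (rule ccontr)
  assume "P1 \<noteq> []"
  have "fat_theta (edges G) y w (rev Q2) (rev P2 @ [u]) (rev R @ x # Q1)"
    using th e Q2 unfolding fat_theta_def theta_def
    by (auto simp: path_edges_subset_iff path_edges_rev last_rev hd_rev insert_commute hd_append split: if_splits)
  then have "set P1 \<subseteq> {y, w} \<union> set Q2 \<union> set P2 \<union> {u} \<union> set R \<union> {x} \<union> set Q1"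
    using spanning[OF th] spanning by fastforce
  then show False using th \<open>P1 \<noteq> []\<close> by (cases P1) (auto simp: fat_theta_def theta_def)
qed

text \<open>\<open>chord_start\<close> applies in four ways, by exchanging the two paths and by
  reversing the theta. The resulting implications leave only two positions when both paths have at
  least two interior vertices.\<close>

lemma chord_ends:
  assumes th: "fat_theta (edges G) x y P Q R" and len: "2 \<le> length P" "2 \<le> length Q"
    and uw: "u \<in> set P" "w \<in> set Q" "{u, w} \<in> edges G"
  shows "u = hd P \<and> w = hd Q \<or> u = last P \<and> w = last Q"
proof -
  obtain P1 P2 where P: "P = P1 @ u # P2" using uw by (meson split_list)
  obtain Q1 Q2 where Q: "Q = Q1 @ w # Q2" using uw by (meson split_list)
  have wu: "{w, u} \<in> edges G" using uw by (simp add: insert_commute)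
  note th = th[unfolded P Q]
  have th_rev: "fat_theta (edges G) y x (rev P2 @ u # rev P1) (rev Q2 @ w # rev Q1) (rev R)"
    using fat_theta_rev[OF th] by simp
  have "Q2 \<noteq> [] \<longrightarrow> P1 = []" "P2 \<noteq> [] \<longrightarrow> Q1 = []" "Q1 \<noteq> [] \<longrightarrow> P2 = []" "P1 \<noteq> [] \<longrightarrow> Q2 = []"
    using chord_start[OF th uw(3)] chord_start[OF fat_theta_perm(1)[OF th] wu]
      chord_start[OF th_rev uw(3)] chord_start[OF fat_theta_perm(1)[OF th_rev] wu] by auto
  then show ?thesis using len unfolding P Q by (cases P1; cases P2; cases Q1; cases Q2) auto
qed

text \<open>The head of \<open>Q\<close> could replace \<open>x\<close> as a branch vertex, giving a
  fat theta that misses \<open>x\<close>.\<close>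

lemma two_head_chords:
  assumes th: "fat_theta (edges G) x y P Q R" and "2 \<le> length Q"
    and "{hd Q, hd P} \<in> edges G" "{hd Q, hd R} \<in> edges G"
  shows False
proof -
  obtain q Q' where Q: "Q = q # Q'" "Q' \<noteq> []" using assms(2) by (cases Q; cases "tl Q") auto
  have "fat_theta (edges G) q y Q' P R"
    using assms unfolding Q fat_theta_def theta_def by (auto simp: path_edges_subset_iff)
  then have "x \<in> {q, y} \<union> set Q' \<union> set P \<union> set R" using spanning[OF th] spanning by fastforce
  then show False using th by (auto simp: Q fat_theta_def theta_def)
qed

lemma two_last_chords:
  assumes "fat_theta (edges G) x y P Q R" "2 \<le> length Q"
    and "{last Q, last P} \<in> edges G" "{last Q, last R} \<in> edges G"
  shows False
  using two_head_chords[OF fat_theta_rev[OF assms(1)]] assms by (simp add: hd_rev)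

text \<open>If \<open>w\<close> were not last, it could serve with \<open>y\<close> as a branch
  vertex: the paths go forward along \<open>Q\<close>, through \<open>q\<close>, and backward along
  \<open>Q\<close> and over the given chord into \<open>R\<close>. This theta misses
  \<open>x\<close>.\<close>

lemma hub_chord:
  assumes th: "fat_theta (edges G) x y [q] Q R" and "{hd Q, hd R} \<in> edges G"
    and w: "w \<in> set Q" "{q, w} \<in> edges G"
  shows "w = last Q"
proof (rule ccontr)
  assume neq: "w \<noteq> last Q"
  obtain Q1 Q2 where Q: "Q = Q1 @ w # Q2" using w by (meson split_list)
  then have "Q2 \<noteq> []" using neq by auto
  then have "fat_theta (edges G) w y Q2 [q] (rev Q1 @ R)"
    using assms unfolding Q fat_theta_def theta_def
    by (cases Q1) (auto simp: path_edges_subset_iff path_edges_rev last_rev hd_rev insert_commute hd_append split: if_splits)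
  then have "x \<in> {w, y} \<union> set Q2 \<union> {q} \<union> set Q1 \<union> set R" using spanning[OF th] spanning by fastforce
  then show False using th by (auto simp: Q fat_theta_def theta_def)
qed

text \<open>Otherwise \<open>q\<close> and the head of \<open>Q\<close> are branch vertices of a fat
  theta whose paths run along the rest of \<open>Q\<close>, through \<open>x\<close>, and along
  \<open>R\<close>. It misses \<open>y\<close>.\<close>

lemma hub_last_chords:
  assumes th: "fat_theta (edges G) x y [q] Q R" and "2 \<le> length Q" and "{hd Q, hd R} \<in> edges G"
    and "{q, last Q} \<in> edges G" "{q, last R} \<in> edges G"
  shows False
proof -
  obtain a Q' where Q: "Q = a # Q'" "Q' \<noteq> []" using assms(2) by (cases Q; cases "tl Q") auto
  have "fat_theta (edges G) q a (rev Q') [x] (rev R)"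
    using assms unfolding Q fat_theta_def theta_def
    by (auto simp: path_edges_subset_iff path_edges_rev last_rev hd_rev insert_commute hd_append)
  then have "y \<in> {q, a} \<union> set Q' \<union> {x} \<union> set R" using spanning[OF th] spanning by fastforce
  then show False using th by (auto simp: Q fat_theta_def theta_def)
qed

section \<open>Assembling the wheel or the prism\<close>

lemma hub_wheel:
  assumes th: "fat_theta (edges G) x y [q] Q R"
    and none: "\<And>u w. u \<in> set Q \<Longrightarrow> w \<in> set R \<Longrightarrow> {u, w} \<notin> edges G"
  shows "wheel_or_prism G"
\<comment> \<open>The rim is the cycle formed by the second and third path. Every edge at
  \<open>q\<close> is a spoke, and no chord joins the two halves of the rim.\<close>
proof (rule wheelI[of q "x # Q @ y # rev R"])
  have d: "distinct (x # y # [q] @ Q @ R)" and ne: "Q \<noteq> []" "R \<noteq> []"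
    using th by (auto simp: fat_theta_def theta_def)
  show "distinct (q # x # Q @ y # rev R)" using d by auto
  show "3 \<le> length (x # Q @ y # rev R)" using ne by (cases Q) auto
  show "verts G = insert q (set (x # Q @ y # rev R))" using spanning[OF th] by auto
  have rim: "path_edges ((x # Q @ y # rev R) @ [hd (x # Q @ y # rev R)]) = path_edges (x # Q @ [y]) \<union> path_edges (x # R @ [y])"
    using path_edges_append[of "x # Q @ [y]" "rev R @ [x]"] path_edges_Cons[of y "rev R @ [x]"]
      path_edges_rev[of "x # R @ [y]"] by auto
  show "edges G \<subseteq> path_edges ((x # Q @ y # rev R) @ [hd (x # Q @ y # rev R)]) \<union> {{q, v} |v. v \<in> set (x # Q @ y # rev R)}"
    unfolding rim
  proof
    fix e assume e: "e \<in> edges G"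
    let ?spokes = "{{q, v} |v. v \<in> set (x # Q @ y # rev R)}"
    have spoke: "{q, v} \<in> ?spokes" if "v \<in> {x, y} \<union> set Q \<union> set R" for v
      using that by auto
    have hub: "path_edges (x # [q] @ [y]) = {{q, x}, {q, y}}" by auto
    from edge_cases[OF th e]
    show "e \<in> path_edges (x # Q @ [y]) \<union> path_edges (x # R @ [y]) \<union> ?spokes"
    proof cases
      case 1
      then show ?thesis unfolding hub using spoke by blast
    next
      case (2 u w)
      then show ?thesis using spoke[of w] by simp
    next
      case (3 u w)
      then show ?thesis using spoke[of w] by simp
    next
      case (4 u w)
      then show ?thesis using none e by blast
    qed
  qed
qed

text \<open>Chords join only heads with heads or lasts with lasts, and at either end at most one of
  the three possible chords exists. Together with the branch vertex at that end it forms a triangle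
  of the prism, and the path without that chord is prolonged by the edge to the branch vertex's
  place, so that \<open>x\<close> or \<open>y\<close> becomes its end.\<close>

lemma prism_case:
  assumes th: "fat_theta (edges G) x y P Q R" and len: "2 \<le> length Q" "2 \<le> length R"
    and P: "2 \<le> length P \<or> {hd Q, hd R} \<in> edges G"
  shows "wheel_or_prism G"
proof -
  note th' = fat_theta_perm(1)[OF th] fat_theta_perm(2)[OF th]
    fat_theta_perm(2)[OF fat_theta_perm(1)[OF th]]
  let ?E = "edges G"
  have d: "distinct (x # y # P @ Q @ R)" and ne: "P \<noteq> []" "Q \<noteq> []" "R \<noteq> []"
    using th by (auto simp: fat_theta_def theta_def)
  have comm: "{u, v} \<in> ?E \<longleftrightarrow> {v, u} \<in> ?E" for u v by (simp add: insert_commute)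
  have single: "P = [hd P] \<and> {hd Q, hd R} \<in> ?E" if "\<not> 2 \<le> length P"
    using that P ne by (cases P; cases "tl P") auto
  have PQ: "u = hd P \<and> w = hd Q \<or> u = last P \<and> w = last Q"
    if "u \<in> set P" "w \<in> set Q" "{u, w} \<in> ?E" for u w
  proof (cases "2 \<le> length P")
    case True
    then show ?thesis using chord_ends[OF th _ len(1)] that by blast
  next
    case False
    then show ?thesis using single hub_chord[of x y "hd P" Q R w] th that
      by (metis empty_set last.simps list.simps(15) singletonD)
  qed
  have PR: "u = hd P \<and> w = hd R \<or> u = last P \<and> w = last R"
    if "u \<in> set P" "w \<in> set R" "{u, w} \<in> ?E" for u w
  proof (cases "2 \<le> length P")
    case True
    then show ?thesis using chord_ends[OF th'(2) _ len(2)] that by blast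
  next
    case False
    then show ?thesis using single hub_chord[of x y "hd P" R Q w] th'(2) that comm[of "hd Q" "hd R"]
      by (metis empty_set last.simps list.simps(15) singletonD)
  qed
  have QR: "u = hd Q \<and> w = hd R \<or> u = last Q \<and> w = last R"
    if "u \<in> set Q" "w \<in> set R" "{u, w} \<in> ?E" for u w
    using chord_ends[OF th'(3) len] that by blast
  have heads: "\<not> ({hd P, hd Q} \<in> ?E \<and> {hd Q, hd R} \<in> ?E)" "\<not> ({hd P, hd R} \<in> ?E \<and> {hd Q, hd R} \<in> ?E)"
    using two_head_chords[OF th len(1)] two_head_chords[OF th'(2) len(2)] comm by blast+
  have headP: "\<not> ({hd P, hd Q} \<in> ?E \<and> {hd P, hd R} \<in> ?E)"
    using two_head_chords[OF th'(1)] heads single by blast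
  have lasts: "\<not> ({last P, last Q} \<in> ?E \<and> {last Q, last R} \<in> ?E)" "\<not> ({last P, last R} \<in> ?E \<and> {last Q, last R} \<in> ?E)"
    using two_last_chords[OF th len(1)] two_last_chords[OF th'(2) len(2)] comm by blast+
  \<comment> \<open>For a one-vertex \<open>P\<close> the replacement of \<open>y\<close> by
    \<open>last P\<close> would leave no interior vertex on that path; the chord between the heads
    of \<open>Q\<close> and \<open>R\<close> is used instead.\<close>
  have lastP: "\<not> ({last P, last Q} \<in> ?E \<and> {last P, last R} \<in> ?E)"
  proof (cases "2 \<le> length P")
    case True
    then show ?thesis using two_last_chords[OF th'(1)] by blast
  next
    case False
    then show ?thesis using single hub_last_chords[of x y "hd P" Q R] th len(1)
      by (metis last.simps)
  qed
  let ?T = "path_edges (x # P @ [y]) \<union> path_edges (x # Q @ [y]) \<union> path_edges (x # R @ [y])"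
  have E: "?E \<subseteq> ?T \<union> ({{hd P, hd Q}, {hd P, hd R}, {hd Q, hd R}} \<inter> ?E)
      \<union> ({{last P, last Q}, {last P, last R}, {last Q, last R}} \<inter> ?E)"
  proof
    fix e assume e: "e \<in> ?E"
    show "e \<in> ?T \<union> ({{hd P, hd Q}, {hd P, hd R}, {hd Q, hd R}} \<inter> ?E)
      \<union> ({{last P, last Q}, {last P, last R}, {last Q, last R}} \<inter> ?E)"
      using edge_cases[OF th e]
    proof cases
      case (2 u w)
      then show ?thesis using PQ[of u w] e by auto
    next
      case (3 u w)
      then show ?thesis using PR[of u w] e by auto
    next
      case (4 u w)
      then show ?thesis using QR[of u w] e by auto
    qed blast
  qed
  \<comment> \<open>\<open>kx\<close> is the number (0, 1, 2 for \<open>P\<close>, \<open>Q\<close>,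
    \<open>R\<close>) of the path that receives \<open>x\<close>, namely the one not incident with
    the chord between heads; 0 is the default if there is no such chord. The second condition
    guarantees that the side path made from \<open>P\<close> has at least two vertices.\<close>
  obtain kx :: nat where kx: "kx < 3" "kx = 0 \<or> 2 \<le> length P"
    "{{hd P, hd Q}, {hd P, hd R}, {hd Q, hd R}} \<inter> ?E \<subseteq>
      {if kx = 0 then {hd Q, hd R} else if kx = 1 then {hd P, hd R} else {hd P, hd Q}}"
  proof -
    consider "{hd P, hd Q} \<in> ?E" | "{hd P, hd R} \<in> ?E" | "{hd P, hd Q} \<notin> ?E" "{hd P, hd R} \<notin> ?E" by blast
    then show thesis
    proof cases
      case 1
      then show thesis using that[of 2] heads headP single by auto
    next
      case 2
      then show thesis using that[of 1] heads headP single by auto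
    next
      case 3
      then show thesis using that[of 0] by auto
    qed
  qed
  obtain ky :: nat where ky: "ky < 3"
    "{{last P, last Q}, {last P, last R}, {last Q, last R}} \<inter> ?E \<subseteq>
      {if ky = 0 then {last Q, last R} else if ky = 1 then {last P, last R} else {last P, last Q}}"
  proof -
    consider "{last P, last Q} \<in> ?E" | "{last P, last R} \<in> ?E" | "{last P, last Q} \<notin> ?E" "{last P, last R} \<notin> ?E" by blast
    then show thesis
    proof cases
      case 1
      then show thesis using that[of 2] lasts lastP by auto
    next
      case 2
      then show thesis using that[of 1] lasts lastP by auto
    next
      case 3
      then show thesis using that[of 0] by auto
    qed
  qed
  define A where "A = (if kx = 0 then [x] else []) @ P @ (if ky = 0 then [y] else [])"
  define B where "B = (if kx = 1 then [x] else []) @ Q @ (if ky = 1 then [y] else [])"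
  define C where "C = (if kx = 2 then [x] else []) @ R @ (if ky = 2 then [y] else [])"
  have k012: "kx = 0 \<or> kx = 1 \<or> kx = 2" "ky = 0 \<or> ky = 1 \<or> ky = 2"
    using kx(1) ky(1) by auto
  show ?thesis
  proof (rule prismI[of A B C])
    show "2 \<le> length A" using kx(2) ne(1) by (cases P) (auto simp: A_def)
    show "2 \<le> length B" "2 \<le> length C" using len by (auto simp: B_def C_def)
    show "distinct (A @ B @ C)"  using k012
      by (elim disjE; use d in \<open>force simp: A_def B_def C_def\<close>)
    show "verts G = set A \<union> set B \<union> set C"  using k012
      unfolding spanning[OF th] by (elim disjE; simp add: A_def B_def C_def; blast)
    have hds: "hd A = (if kx = 0 then x else hd P)" "hd B = (if kx = 1 then x else hd Q)"
      "hd C = (if kx = 2 then x else hd R)"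
      using ne by (auto simp: A_def B_def C_def)
    have lsts: "last A = (if ky = 0 then y else last P)" "last B = (if ky = 1 then y else last Q)"
      "last C = (if ky = 2 then y else last R)"
      using ne by (auto simp: A_def B_def C_def)
    define tri where "tri = {{hd A, hd B}, {hd A, hd C}, {hd B, hd C}} \<union> {{last A, last B}, {last A, last C}, {last B, last C}}"
    \<comment> \<open>On the path that receives \<open>x\<close> this is the new first edge; on the
      other two it is a side of the triangle at \<open>x\<close>.\<close>
    have xe: "{x, hd P} \<in> path_edges A \<union> tri" "{x, hd Q} \<in> path_edges B \<union> tri" "{x, hd R} \<in> path_edges C \<union> tri"
      using k012(1) ne unfolding tri_def hds by (auto simp: A_def B_def C_def path_edges_Cons insert_commute)
    have ye: "{last P, y} \<in> path_edges A \<union> tri" "{last Q, y} \<in> path_edges B \<union> tri" "{last R, y} \<in> path_edges C \<union> tri"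
      using k012(2) ne unfolding tri_def lsts by (auto simp: A_def B_def C_def path_edges_append insert_commute)
    have inner: "path_edges P \<subseteq> path_edges A" "path_edges Q \<subseteq> path_edges B" "path_edges R \<subseteq> path_edges C"
      by (auto simp: A_def B_def C_def path_edges_append)
    have T: "path_edges (x # P @ [y]) = {{x, hd P}, {last P, y}} \<union> path_edges P"
      "path_edges (x # Q @ [y]) = {{x, hd Q}, {last Q, y}} \<union> path_edges Q"
      "path_edges (x # R @ [y]) = {{x, hd R}, {last R, y}} \<union> path_edges R"
      using ne by (auto simp: path_edges_append path_edges_Cons)
    have "?T \<subseteq> path_edges A \<union> path_edges B \<union> path_edges C \<union> tri"
      unfolding T Un_subset_iff insert_subset using xe ye inner by blast
    moreover have "(if kx = 0 then {hd Q, hd R} else if kx = 1 then {hd P, hd R} else {hd P, hd Q}) \<in> tri"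
      using k012(1) unfolding tri_def hds by auto
    then have "{{hd P, hd Q}, {hd P, hd R}, {hd Q, hd R}} \<inter> ?E \<subseteq> tri" using kx(3) by (rule subset_singleton_trans)
    moreover have "(if ky = 0 then {last Q, last R} else if ky = 1 then {last P, last R} else {last P, last Q}) \<in> tri"
      using k012(2) unfolding tri_def lsts by auto
    then have "{{last P, last Q}, {last P, last R}, {last Q, last R}} \<inter> ?E \<subseteq> tri" using ky(2) by (rule subset_singleton_trans)
    ultimately have "?T \<union> ({{hd P, hd Q}, {hd P, hd R}, {hd Q, hd R}} \<inter> ?E)
      \<union> ({{last P, last Q}, {last P, last R}, {last Q, last R}} \<inter> ?E) \<subseteq> path_edges A \<union> path_edges B \<union> path_edges C \<union> tri"
      by (simp only: Un_least le_supI2)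
    then have "?E \<subseteq> path_edges A \<union> path_edges B \<union> path_edges C \<union> tri" using E by (rule order_trans[rotated])
    then show "?E \<subseteq> path_edges A \<union> path_edges B \<union> path_edges C
      \<union> {{hd A, hd B}, {hd A, hd C}, {hd B, hd C}} \<union> {{last A, last B}, {last A, last C}, {last B, last C}}"
      unfolding tri_def by (simp only: Un_assoc)
  qed
qed

text \<open>If \<open>P\<close> has a single vertex, either no chord joins \<open>Q\<close> and
  \<open>R\<close> and this vertex is a hub, or there is such a chord at one end, and after a
  possible reversal it satisfies the alternative hypothesis of \<open>prism_case\<close>.\<close>

lemma long_case:
  assumes th: "fat_theta (edges G) x y P Q R" and len: "2 \<le> length Q" "2 \<le> length R"
  shows "wheel_or_prism G"
proof (cases "2 \<le> length P")
  case True
  then show ?thesis using prism_case[OF th len] by blast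
next
  case False
  moreover have "P \<noteq> []" using th by (simp add: fat_theta_def)
  ultimately obtain q where P: "P = [q]" by (cases P; cases "tl P") auto
  show ?thesis
  proof (cases "\<exists>u\<in>set Q. \<exists>w\<in>set R. {u, w} \<in> edges G")
    case False
    then show ?thesis using hub_wheel th unfolding P by blast
  next
    case True
    have "fat_theta (edges G) x y Q R P" using th by (auto simp: fat_theta_def theta_def)
    then have "{hd Q, hd R} \<in> edges G \<or> {last Q, last R} \<in> edges G"
      using chord_ends[OF _ len] True by blast
    then show ?thesis
    proof
      assume "{hd Q, hd R} \<in> edges G"
      then show ?thesis using prism_case[OF th len] by blast
    next
      assume "{last Q, last R} \<in> edges G"
      then show ?thesis using prism_case[OF fat_theta_rev[OF th]] len by (simp add: hd_rev)
    qed
  qed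
qed

text \<open>\<open>q\<close> and \<open>a\<close> are branch vertices of another fat theta, with
  paths through \<open>x\<close>, through \<open>y\<close> and along the segment of \<open>R\<close>
  between \<open>b\<close> and \<open>c\<close>. It must span, so the segment is all of
  \<open>R\<close>, and its branch vertices are not adjacent.\<close>

lemma two_hubs_chords:
  assumes th: "fat_theta (edges G) x y [q] [a] R"
    and b: "b \<in> set R" "{q, b} \<in> edges G" and c: "c \<in> set R" "{a, c} \<in> edges G"
  shows "{q, a} \<notin> edges G \<and> (b = hd R \<and> c = last R \<or> b = last R \<and> c = hd R)"
proof -
  have sub: "{q, a} \<notin> edges G \<and> R1 = [] \<and> R2 = []"
    if R: "R = R1 @ S @ R2" and S: "S \<noteq> []" "hd S = b \<and> last S = c \<or> hd S = c \<and> last S = b" for R1 S R2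
  proof -
    obtain T where T: "set T = set S" "T \<noteq> []" "hd T = b" "last T = c" "distinct T" "path_edges T \<subseteq> edges G"
    proof -
      have "distinct S" "path_edges S \<subseteq> edges G"
        using th S(1) unfolding R fat_theta_def theta_def by (auto simp: path_edges_subset_iff)
      then show thesis using that[of S] that[of "rev S"] S by (auto simp: hd_rev last_rev path_edges_rev)
    qed
    have "fat_theta (edges G) q a [x] [y] T"
      using th T b c unfolding R fat_theta_def theta_def by (auto simp: path_edges_subset_iff insert_commute)
    then have "{q, a} \<notin> edges G" "set R \<subseteq> {q, a, x, y} \<union> set S"
      using spanning[OF th] spanning nonadjacent T(1) by fastforce+
    then show ?thesis using th unfolding R fat_theta_def theta_def by (cases R1; cases R2) auto
  qed
  obtain R1 R2 where R: "R = R1 @ b # R2" using b by (meson split_list)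
  then consider "c = b" | "c \<in> set R1" | "c \<in> set R2" using c by auto
  then show ?thesis
  proof cases
    case 1
    then show ?thesis using sub[of R1 "[b]" R2] R by auto
  next
    case 2
    then obtain R3 R4 where "R1 = R3 @ c # R4" by (meson split_list)
    then show ?thesis using sub[of R3 "c # R4 @ [b]" R2] R by auto
  next
    case 3
    then obtain R3 R4 where "R2 = R3 @ c # R4" by (meson split_list)
    then show ?thesis using sub[of R1 "b # R3 @ [c]" R4] R by auto
  qed
qed

text \<open>The triangles of the prism are \<open>q\<close>, \<open>x\<close>, \<open>hd R\<close>
  and \<open>y\<close>, \<open>a\<close>, \<open>last R\<close>. The two branch vertices thus lie on
  different side paths, \<open>x\<close> with \<open>a\<close> and \<open>y\<close> with
  \<open>q\<close>.\<close>

lemma two_hubs_prism: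
  assumes th: "fat_theta (edges G) x y [q] [a] R" and len: "2 \<le> length R"
    and q: "{q, hd R} \<in> edges G" and a: "{a, last R} \<in> edges G"
  shows "wheel_or_prism G"
proof (rule prismI[of "[q, y]" "[x, a]" R])
  have d: "distinct (x # y # [q] @ [a] @ R)" and ne: "R \<noteq> []"
    using th by (auto simp: fat_theta_def theta_def)
  have neq: "hd R \<noteq> last R" using len d by (intro hd_neq_last) auto
  have hl: "hd R \<in> set R" "last R \<in> set R" using ne by auto
  have nqa: "{q, a} \<notin> edges G" using two_hubs_chords[OF th hl(1) q hl(2) a] by simp
  have qb: "b = hd R" if "b \<in> set R" "{q, b} \<in> edges G" for b
    using two_hubs_chords[OF th that hl(2) a] neq by auto
  have ab: "b = last R" if "b \<in> set R" "{a, b} \<in> edges G" for b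
    using two_hubs_chords[OF th hl(1) q that] neq by auto
  show "edges G \<subseteq> path_edges [q, y] \<union> path_edges [x, a] \<union> path_edges R \<union>
    {{hd [q, y], hd [x, a]}, {hd [q, y], hd R}, {hd [x, a], hd R}} \<union>
    {{last [q, y], last [x, a]}, {last [q, y], last R}, {last [x, a], last R}}"
  proof
    fix e assume e: "e \<in> edges G"
    have T: "path_edges (x # R @ [y]) = {{x, hd R}, {last R, y}} \<union> path_edges R"
      using ne by (auto simp: path_edges_append path_edges_Cons)
    from edge_cases[OF th e]
    have "e \<in> {{x, q}, {q, y}, {x, a}, {a, y}, {x, hd R}, {last R, y}, {q, hd R}, {a, last R}} \<union> path_edges R"
    proof cases
      case 1
      moreover have "path_edges (x # [c] @ [y]) = {{x, c}, {c, y}}" for c by simp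
      ultimately have "e \<in> {{x, q}, {q, y}} \<union> {{x, a}, {a, y}} \<union> ({{x, hd R}, {last R, y}} \<union> path_edges R)"
        by (simp only: T)
      then show ?thesis by (elim UnE insertE emptyE) simp_all
    next
      case (2 u w)
      then show ?thesis using nqa e by auto
    next
      case (3 u w)
      then show ?thesis using qb e by auto
    next
      case (4 u w)
      then show ?thesis using ab e by auto
    qed
    then show "e \<in> path_edges [q, y] \<union> path_edges [x, a] \<union> path_edges R \<union>
      {{hd [q, y], hd [x, a]}, {hd [q, y], hd R}, {hd [x, a], hd R}} \<union>
      {{last [q, y], last [x, a]}, {last [q, y], last R}, {last [x, a], last R}}"
      by (auto simp: insert_commute)
  qed
  show "verts G = set [q, y] \<union> set [x, a] \<union> set R" using spanning[OF th] by auto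
qed (use assms in \<open>auto simp: fat_theta_def theta_def\<close>)

text \<open>If one of \<open>q\<close> and \<open>a\<close> has no neighbour in \<open>R\<close>,
  the other is the hub of a wheel. If both have one, the positions are forced by
  \<open>two_hubs_chords\<close>.\<close>

lemma two_hubs_case:
  assumes th: "fat_theta (edges G) x y [q] [a] R"
  shows "wheel_or_prism G"
proof -
  have ne: "R \<noteq> []" using th by (simp add: fat_theta_def)
  consider "\<forall>b\<in>set R. {a, b} \<notin> edges G" | "\<forall>b\<in>set R. {q, b} \<notin> edges G"
    | b c where "b \<in> set R" "{q, b} \<in> edges G" "c \<in> set R" "{a, c} \<in> edges G"
    by blast
  then show ?thesis
  proof cases
    case 1
    then show ?thesis by (intro hub_wheel[OF th]) auto
  next
    case 2
    then show ?thesis by (intro hub_wheel[OF fat_theta_perm(1)[OF th]]) auto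
  next
    case 3
    note chords = two_hubs_chords[OF th 3]
    show ?thesis
    proof (cases "2 \<le> length R")
      case True
      from chords consider "b = hd R" "c = last R" | "b = last R" "c = hd R" by blast
      then show ?thesis
      proof cases
        case 1
        then show ?thesis using two_hubs_prism[OF th True] 3 by blast
      next
        case 2
        have "fat_theta (edges G) y x [q] [a] (rev R)" using fat_theta_rev[OF th] by simp
        then show ?thesis
          using two_hubs_prism[of y x q a "rev R"] True 3 2 by (simp add: hd_rev last_rev)
      qed
    next
      case False
      then obtain r where R: "R = [r]" using ne by (cases R; cases "tl R") auto
      show ?thesis
      \<comment> \<open>The only vertex \<open>r\<close> of \<open>R\<close> is adjacent to
        \<open>x\<close>, \<open>y\<close>, \<open>q\<close> and \<open>a\<close>, while
        \<open>q\<close> and \<open>a\<close> are not adjacent: the hub is \<open>r\<close>.\<close>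
      proof (rule wheelI[of r "[x, q, y, a]"])
        show "edges G \<subseteq> path_edges ([x, q, y, a] @ [hd [x, q, y, a]]) \<union> {{r, v} |v. v \<in> set [x, q, y, a]}"
        proof
          fix e assume e: "e \<in> edges G"
          from edge_cases[OF th e]
          have "e \<in> {{x, q}, {q, y}, {x, a}, {a, y}, {x, r}, {r, y}, {q, r}, {a, r}}"
          proof cases
            case 1
            moreover have "path_edges (x # [c] @ [y]) = {{x, c}, {c, y}}" for c by simp
            ultimately have "e \<in> {{x, q}, {q, y}} \<union> {{x, a}, {a, y}} \<union> {{x, r}, {r, y}}"
              by (simp only: R)
            then show ?thesis by (elim UnE insertE emptyE) simp_all
          next
            case (2 u w)
            then show ?thesis using chords e by auto
          next
            case (3 u w)
            then show ?thesis using R by auto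
          next
            case (4 u w)
            then show ?thesis using R by auto
          qed
          then show "e \<in> path_edges ([x, q, y, a] @ [hd [x, q, y, a]]) \<union> {{r, v} |v. v \<in> set [x, q, y, a]}"
            by (auto simp: insert_commute)
        qed
        show "verts G = insert r (set [x, q, y, a])" using spanning[OF th] unfolding R by auto
      qed (use th in \<open>auto simp: R fat_theta_def theta_def\<close>)
    qed
  qed
qed

text \<open>Pigeonhole on the three paths: two of them have at least two interior vertices, or two
  of them have exactly one.\<close>

theorem fat_theta_wheel_or_prism:
  assumes th: "fat_theta (edges G) x y P Q R"
  shows "wheel_or_prism G"
proof -
  have ne: "P \<noteq> []" "Q \<noteq> []" "R \<noteq> []" using th by (auto simp: fat_theta_def)
  have short: "\<exists>q. xs = [q]" if "xs \<noteq> []" "\<not> 2 \<le> length xs" for xs :: "'v list"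
    using that by (cases xs; cases "tl xs") auto
  note p1 = fat_theta_perm(1) and p2 = fat_theta_perm(2)
  consider "2 \<le> length Q" "2 \<le> length R" | "2 \<le> length P" "2 \<le> length R" | "2 \<le> length P" "2 \<le> length Q"
    | "\<not> 2 \<le> length P" "\<not> 2 \<le> length Q" | "\<not> 2 \<le> length P" "\<not> 2 \<le> length R"
    | "\<not> 2 \<le> length Q" "\<not> 2 \<le> length R" by blast
  then show ?thesis
  proof cases
    case 1 then show ?thesis using long_case[OF th] by blast
  next
    case 2 then show ?thesis using long_case[OF p1[OF th]] by blast
  next
    case 3 then show ?thesis using long_case[OF p1[OF p2[OF th]]] by blast
  next
    case 4 then show ?thesis using two_hubs_case th short ne by metis
  next
    case 5 then show ?thesis using two_hubs_case p2[OF th] short ne by metis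
  next
    case 6 then show ?thesis using two_hubs_case p2[OF p1[OF th]] short ne by metis
  qed
qed

end

theorem theorem2:
  fixes G :: "'v graph"
  assumes "finite_simple_graph G"
    and "nonseparating_planar G"
  shows "outerplanar G \<or>
    (\<exists>n\<ge>3. isomorphic_to_subgraph G (wheel n)) \<or>
    (\<exists>l. (\<forall>i<3. 1 \<le> l i) \<and> isomorphic_to_subgraph G (elongated_prism l))"
proof -
  obtain p \<gamma> where "planar_drawing G p \<gamma>" "\<not> (\<exists>vs. separating_cycle G p \<gamma> vs)"
    using assms(2) by (auto simp: nonseparating_planar_def)
  then interpret nonseparating_drawing G p \<gamma>
    using assms(1) by unfold_locales auto
  interpret theta_graph G
    using assms(1) fat_theta_spanning fat_theta_nonadjacent by unfold_locales
  have "outerplanar G \<or> wheel_or_prism G"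
  proof (cases "fat_theta_free (edges G)")
    case False
    then show ?thesis using fat_theta_wheel_or_prism unfolding fat_theta_free_def by blast
  next
    case ftf: True
    show ?thesis
    proof (cases "K4_free (edges G)")
      case True
      have "finite (verts G)" "\<And>e. e \<in> edges G \<Longrightarrow> e \<subseteq> verts G \<and> card e = 2"
        using assms(1) by (auto simp: finite_simple_graph_def)
      then show ?thesis
        using noncrossing_order_exists ftf True outerplanar_of_noncrossing[OF assms(1)] by metis
    next
      case False
      then obtain a b c d where d: "distinct [a, b, c, d]"
        and E: "{a, b} \<in> edges G" "{a, c} \<in> edges G" "{a, d} \<in> edges G"
          "{b, c} \<in> edges G" "{b, d} \<in> edges G" "{c, d} \<in> edges G"
        unfolding K4_free_def by blast
      note V = K4_spanning[OF d E]
      have "wheel_or_prism G"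
      proof (rule wheelI[of a "[b, c, d]"])
        show "edges G \<subseteq> path_edges ([b, c, d] @ [hd [b, c, d]]) \<union> {{a, v} |v. v \<in> set [b, c, d]}"
        proof
          fix e assume "e \<in> edges G"
          then obtain u v where uv: "e = {u, v}" "u \<noteq> v" "u \<in> {a, b, c, d}" "v \<in> {a, b, c, d}"
            using edge_ends V by metis
          have "{{a, v} |v. v \<in> set [b, c, d]} = {{a, b}, {a, c}, {a, d}}" by auto
          moreover have "path_edges ([b, c, d] @ [hd [b, c, d]]) = {{b, c}, {c, d}, {d, b}}" by simp
          moreover have "e \<in> {{b, c}, {c, d}, {d, b}} \<union> {{a, b}, {a, c}, {a, d}}"
            using uv by (elim insertE emptyE) (simp_all add: insert_commute)
          ultimately show "e \<in> path_edges ([b, c, d] @ [hd [b, c, d]]) \<union> {{a, v} |v. v \<in> set [b, c, d]}"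
            by (simp only:)
        qed
      qed (use d V in auto)
      then show ?thesis ..
    qed
  qed
  then show ?thesis by (simp add: wheel_or_prism_def)
qed

end
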